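(* Each irreducible character $\chi\in\mathrm{Irr}(S_n)$ can be computed from the positive integer $n$ and the ratios $\rho_\chi((r))=\chi((r))/\chi(1)$, $2\le r\le n$. More precisely, for any partition $\lambda$ of a positive integer $m$, there exists a polynomial $T_\lambda(t_{(2)},t_{(3)},\dots,t_{(\Vert\lambda\Vert+1)})$ over the field of rational functions $\mathbb{Q}(N)$ such that (i) for any $n\ge m$ and any $\chi\in\mathrm{Irr}(S_n)$, $\rho_\chi(\lambda)=T_\lambda\big(\rho_\chi((2)),\dots,\rho_\chi((\Vert\lambda\Vert+1))\big)(n)$, where the number $n$ is plugged into the variable $N$; and (ii) if $\frac{p(N)}{q(N)}\prod_{i=1}^{\Vert\lambda\Vert}t_{(i+1)}^{b_i}$ appears as a term in $T_\lambda$, where $p(N),q(N)\in\mathbb{Q}[N]$ are relatively prime, then $\deg p\le\deg q$, $\sum_{i=1}^{\Vert\lambda\Vert}b_i i\le\Vert\lambda\Vert$, $\sum_{i=1}^{\Vert\lambda\Vert}b_i i\equiv\Vert\lambda\Vert \pmod 2$, and $\sum_{i=1}^{\Vert\lambda\Vert}b_i(i+1)\le\mathrm{supp}(\lambda)$.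
   Context: $\mathrm{Irr}(S_n)$ is the set of complex irreducible characters of $S_n$. A partition $\lambda$ of $m$ is identified with the partitions of larger numbers $n\ge m$ obtained by adding parts of size $1$, and with the corresponding conjugacy class (cycle type) of $S_n$; parts of size $1$ are usually omitted, so $(r)$ denotes the class of $r$-cycles. $\chi(\lambda)$ is the value of $\chi$ on the class $\lambda$, and $\rho_\chi(\lambda)=\chi(\lambda)/\chi(1)$. Writing the parts of $\lambda$ of size at least $2$ as $(\lambda_1^{a_1},\dots,\lambda_r^{a_r})$ ($a_i$ parts of size $\lambda_i$), set $\mathrm{supp}(\lambda)=\sum_i a_i\lambda_i$ and $\Vert\lambda\Vert=\sum_i a_i(\lambda_i-1)$. *)

theory Defs
  imports
    "HOL-Algebra.Sym_Groups"
    "HOL-Combinatorics.Orbits"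
    "HOL-Library.Poly_Mapping"
    "HOL-Computational_Algebra.Field_as_Ring"
    "HOL-Number_Theory.Cong"
    "HOL-Computational_Algebra.Polynomial_Factorial"
    "HOL-Computational_Algebra.Normalized_Fraction"
    "Jordan_Normal_Form.VS_Connect"
begin

section \<open>Complex irreducible characters\<close>

text \<open>A representation of degree \<open>d\<close> is a homomorphism into the general linear group,
  here the unit group of the ring of complex \<open>d \<times> d\<close> matrices.\<close>

definition representation :: "('g, 'b) monoid_scheme \<Rightarrow> nat \<Rightarrow> ('g \<Rightarrow> complex mat) \<Rightarrow> bool" where
  "representation G d R \<longleftrightarrow> R \<in> hom G (units_of (ring_mat TYPE(complex) d ()))"

definition irreducible_representation ::
    "('g, 'b) monoid_scheme \<Rightarrow> nat \<Rightarrow> ('g \<Rightarrow> complex mat) \<Rightarrow> bool" where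
  "irreducible_representation G d R \<longleftrightarrow>
     representation G d R \<and> d > 0 \<and>
     (\<forall>W. VectorSpace.subspace class_ring W (module_vec TYPE(complex) d) \<and>
          (\<forall>g\<in>carrier G. \<forall>w\<in>W. R g *\<^sub>v w \<in> W)
        \<longrightarrow> W = {0\<^sub>v d} \<or> W = carrier_vec d)"

text \<open>Characters are made extensional on the carrier, so that equality of characters is
  equality of functions.\<close>

definition character_of :: "('g, 'b) monoid_scheme \<Rightarrow> nat \<Rightarrow> ('g \<Rightarrow> complex mat) \<Rightarrow> 'g \<Rightarrow> complex" where
  "character_of G d R = (\<lambda>g\<in>carrier G. \<Sum>i<d. R g $$ (i, i))"

definition Irr :: "('g, 'b) monoid_scheme \<Rightarrow> ('g \<Rightarrow> complex) set" where
  "Irr G = {character_of G d R | d R. irreducible_representation G d R}"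


section \<open>Partitions and cycle types\<close>

text \<open>Partitions are multisets of positive natural numbers; parts equal to 1 are allowed.\<close>

definition is_partition_of :: "nat multiset \<Rightarrow> nat \<Rightarrow> bool" where
  "is_partition_of \<mu> m \<longleftrightarrow> (\<forall>k\<in>#\<mu>. k \<ge> 1) \<and> sum_mset \<mu> = m"

definition part_supp :: "nat multiset \<Rightarrow> nat" where
  "part_supp \<mu> = (\<Sum>k\<in>#filter_mset (\<lambda>k. k \<ge> 2) \<mu>. k)"

definition part_norm :: "nat multiset \<Rightarrow> nat" where
  "part_norm \<mu> = (\<Sum>k\<in>#filter_mset (\<lambda>k. k \<ge> 2) \<mu>. k - 1)"

definition cycle_type :: "nat \<Rightarrow> (nat \<Rightarrow> nat) \<Rightarrow> nat multiset" where
  "cycle_type n \<sigma> = image_mset card (mset_set (orbit \<sigma> ` {1..n}))"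

text \<open>The class of \<open>S\<^sub>n\<close> denoted by a partition \<open>\<mu>\<close> of some \<open>m \<le> n\<close>: the parts of \<open>\<mu>\<close> are
  completed by \<open>n - m\<close> parts equal to 1. It is empty if \<open>\<mu>\<close> is a partition of some \<open>m > n\<close>.\<close>

definition cycle_class :: "nat \<Rightarrow> nat multiset \<Rightarrow> (nat \<Rightarrow> nat) set" where
  "cycle_class n \<mu> =
     {\<sigma> \<in> carrier (sym_group n). cycle_type n \<sigma> = \<mu> + replicate_mset (n - sum_mset \<mu>) 1}"

text \<open>\<open>the_elem\<close> selects the single value that a class function takes on the class.\<close>

definition class_value :: "nat \<Rightarrow> ((nat \<Rightarrow> nat) \<Rightarrow> complex) \<Rightarrow> nat multiset \<Rightarrow> complex" where
  "class_value n \<chi> \<mu> = the_elem (\<chi> ` cycle_class n \<mu>)"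

definition char_ratio :: "nat \<Rightarrow> ((nat \<Rightarrow> nat) \<Rightarrow> complex) \<Rightarrow> nat multiset \<Rightarrow> complex" where
  "char_ratio n \<chi> \<mu> = class_value n \<chi> \<mu> / \<chi> \<one>\<^bsub>sym_group n\<^esub>"


section \<open>Polynomials over the field of rational functions\<close>

text \<open>The field \<open>\<rat>(N)\<close> is \<open>rat poly fract\<close>. A monomial is its finitely supported exponent
  function; the exponent of the variable \<open>t\<^sub>(\<^sub>r\<^sub>)\<close> is stored at \<open>r\<close>.\<close>

type_synonym ratfun = "rat poly fract"
type_synonym ratfun_mpoly = "(nat \<Rightarrow>\<^sub>0 nat) \<Rightarrow>\<^sub>0 ratfun"

definition mpoly_vars :: "ratfun_mpoly \<Rightarrow> nat set" where
  "mpoly_vars T = (\<Union>b\<in>Poly_Mapping.keys T. Poly_Mapping.keys b)"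

text \<open>\<open>quot_of_fract\<close> yields numerator and denominator in lowest terms. The value
  \<open>ratfun_eval\<close> is meaningful only where \<open>ratfun_defined_at\<close> holds.\<close>

definition ratfun_defined_at :: "ratfun \<Rightarrow> rat \<Rightarrow> bool" where
  "ratfun_defined_at f x \<longleftrightarrow> poly (snd (quot_of_fract f)) x \<noteq> 0"

definition ratfun_eval :: "ratfun \<Rightarrow> rat \<Rightarrow> rat" where
  "ratfun_eval f x = poly (fst (quot_of_fract f)) x / poly (snd (quot_of_fract f)) x"

definition mpoly_eval :: "ratfun_mpoly \<Rightarrow> (nat \<Rightarrow> complex) \<Rightarrow> nat \<Rightarrow> complex" where
  "mpoly_eval T t n =
     (\<Sum>b\<in>Poly_Mapping.keys T. of_rat (ratfun_eval (Poly_Mapping.lookup T b) (of_nat n)) *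
        (\<Prod>r\<in>Poly_Mapping.keys b. t r ^ Poly_Mapping.lookup b r))"

end

theory Submission
  imports Defs "Jordan_Normal_Form.Spectral_Radius"
begin

text \<open>
  Let \<open>\<chi>\<close> be an irreducible character of \<open>S\<^sub>n\<close> and \<open>\<rho>(z) = \<chi>(z) / \<chi>(1)\<close>. By Schur's lemma the average of
  the matrices of the conjugates of \<open>x\<close> is the scalar \<open>\<rho>(x)\<close>, so the average of \<open>\<rho>(g x g\<^sup>-\<^sup>1 y)\<close> over
  \<open>g\<close> is \<open>\<rho>(x) \<rho>(y)\<close> (\<open>character_conj_sum\<close>).

  Let \<open>\<lambda>\<close> consist of a part \<open>r\<close> and further parts \<open>\<beta>\<close>, all at least 2, and let \<open>y\<close> be a
  permutation of \<open>{1..s}\<close> of type \<open>\<beta>\<close> with \<open>s = supp(\<beta>)\<close>. Letting the cycle \<open>(u\<^sub>1 \<dots> u\<^sub>r)\<close> run over all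
  lists \<open>u\<close> of distinct points of \<open>{1..n}\<close>, the averaging identity becomes
  \<open>n (n-1) \<dots> (n-r+1) \<rho>((r)) \<rho>(\<beta>) = \<Sum>\<^sub>u \<rho>((u\<^sub>1 \<dots> u\<^sub>r) y)\<close>.
  The summand depends only on how \<open>u\<close> meets \<open>{1..s}\<close>. The lists that avoid \<open>{1..s}\<close> all give type
  \<open>\<lambda>\<close>, and there are \<open>(n-s) (n-s-1) \<dots> (n-s-r+1)\<close> of them. Every other pattern of intersection occurs for a
  number of lists which is a polynomial in \<open>n\<close> of degree at most \<open>r\<close>, and it gives a permutation that is
  conjugate to one of \<open>{1..s+r-1}\<close>, hence of smaller support than \<open>\<lambda>\<close> (\<open>cycle_sum_expansion\<close>).
  Solving for \<open>\<rho>(\<lambda>)\<close> and recursing on the support gives the polynomial \<open>T\<^sub>\<lambda>\<close>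
  (\<open>expressible_char_ratio\<close>). The leading factor has degree exactly \<open>r\<close> and no root \<open>n \<ge> supp(\<lambda>)\<close>, so the
  quotients are defined at all these \<open>n\<close> and have numerators of no larger degree than their denominators.

  The restrictions on the exponents come from the length function: \<open>\<parallel>\<cdot>\<parallel>\<close> of a permutation of \<open>{1..n}\<close> is
  \<open>n\<close> minus its number of cycles, and multiplication by a transposition joins two cycles or cuts one.
  An \<open>r\<close>-cycle is a product of \<open>r - 1\<close> transpositions, so every permutation in the sum has length at
  most \<open>r - 1 + \<parallel>\<beta>\<parallel> = \<parallel>\<lambda>\<parallel>\<close> and of the same parity (\<open>part_norm_cycle_compose\<close>).

  Finally, the ratios on cycles determine all ratios \<open>\<rho>\<close>, and \<open>\<rho>\<close> determines \<open>\<chi>\<close> because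
  \<open>\<Sum>\<^sub>g \<chi>(g) \<chi>(g\<^sup>-\<^sup>1) = n!\<close> fixes the degree (\<open>Irr_sym_group_determined\<close>).
\<close>

section \<open>Schur orthogonality and central sums\<close>

lemma mat_mult_entry:
  assumes "A \<in> carrier_mat d d" "B \<in> carrier_mat d d" "i < d" "j < d"
  shows "(A * B) $$ (i, j) = (\<Sum>k<d. A $$ (i, k) * B $$ (k, j))"
  using assms by (auto simp: scalar_prod_def atLeast0LessThan)

locale irreducible_rep = group G for G (structure) +
  fixes d :: nat and R :: "'a \<Rightarrow> complex mat"
  assumes irr: "irreducible_representation G d R"
    and fin: "finite (carrier G)"
begin

lemma R_hom: "R \<in> hom G (units_of (ring_mat TYPE(complex) d ()))"
  using irr by (simp add: irreducible_representation_def representation_def)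

lemma d_pos: "d > 0"
  using irr by (simp add: irreducible_representation_def)

lemma R_carrier [simp]: "g \<in> carrier G \<Longrightarrow> R g \<in> carrier_mat d d"
  using R_hom by (auto simp: hom_def units_of_def Units_def ring_mat_def)

lemma R_mult: "g \<in> carrier G \<Longrightarrow> h \<in> carrier G \<Longrightarrow> R (g \<otimes> h) = R g * R h"
  using R_hom by (auto simp: hom_def units_of_def ring_mat_def)

lemma R_one: "R \<one> = 1\<^sub>m d"
proof -
  interpret M: ring "ring_mat TYPE(complex) d ()" by (rule ring_mat)
  have "group (units_of (ring_mat TYPE(complex) d ()))" by (rule M.units_group)
  from hom_one[OF R_hom is_group this] show ?thesis
    by (simp add: units_of_def ring_mat_def)
qed

lemma R_mult_entry:
  assumes "g \<in> carrier G" "h \<in> carrier G" "i < d" "j < d"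
  shows "R (g \<otimes> h) $$ (i, j) = (\<Sum>k<d. R g $$ (i, k) * R h $$ (k, j))"
  using assms by (simp add: R_mult mat_mult_entry)

text \<open>Over the complex numbers \<open>M\<close> has an eigenvalue. The eigenspace is invariant because \<open>M\<close> commutes with
the representation, and it is not zero, so irreducibility makes it the whole space.\<close>

lemma schur:
  assumes M: "M \<in> carrier_mat d d"
    and comm: "\<And>g. g \<in> carrier G \<Longrightarrow> R g * M = M * R g"
  shows "\<exists>c. M = c \<cdot>\<^sub>m 1\<^sub>m d"
proof -
  obtain c v where v: "eigenvector M v c"
    using spectrum_non_empty[OF M d_pos] by (auto simp: spectrum_def eigenvalue_def)
  define W where "W = {w \<in> carrier_vec d. M *\<^sub>v w = c \<cdot>\<^sub>v w}"
  interpret V: vec_space "TYPE(complex)" d .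
  have "VectorSpace.subspace class_ring W (module_vec TYPE(complex) d)"
  proof (intro VectorSpace.subspace.intro submodule.intro)
    show "vectorspace class_ring (module_vec TYPE(complex) d)" by (rule V.vectorspace_axioms)
    show "module class_ring (module_vec TYPE(complex) d)" by (rule V.module_axioms)
  qed (use M in \<open>auto simp: W_def module_vec_simps mult_add_distrib_mat_vec
        mult_mat_vec smult_add_distrib_vec smult_smult_assoc mult.commute\<close>)
  moreover have "R g *\<^sub>v w \<in> W" if "g \<in> carrier G" "w \<in> W" for g w
  proof -
    from that have g: "R g \<in> carrier_mat d d" and w: "w \<in> carrier_vec d" "M *\<^sub>v w = c \<cdot>\<^sub>v w"
      by (auto simp: W_def)
    have "M *\<^sub>v (R g *\<^sub>v w) = (R g * M) *\<^sub>v w"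
      using assoc_mult_mat_vec[OF M g w(1)] comm[OF that(1)] by simp
    also have "\<dots> = R g *\<^sub>v (c \<cdot>\<^sub>v w)"
      using assoc_mult_mat_vec[OF g M w(1)] w(2) by simp
    also have "\<dots> = c \<cdot>\<^sub>v (R g *\<^sub>v w)"
      using mult_mat_vec[OF g w(1)] by simp
    finally show ?thesis using g w by (auto simp: W_def)
  qed
  ultimately have "W = {0\<^sub>v d} \<or> W = carrier_vec d"
    using irr by (auto simp: irreducible_representation_def)
  moreover have "v \<in> W" "v \<noteq> 0\<^sub>v d"
    using v M by (auto simp: eigenvector_def W_def)
  ultimately have W: "W = carrier_vec d" by blast
  have "M $$ (i, j) = (c \<cdot>\<^sub>m 1\<^sub>m d) $$ (i, j)" if "i < d" "j < d" for i j
  proof -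
    have "M *\<^sub>v unit_vec d j = c \<cdot>\<^sub>v unit_vec d j"
      using W unit_vec_carrier[of d j] unfolding W_def by blast
    hence "(M *\<^sub>v unit_vec d j) $ i = (c \<cdot>\<^sub>v unit_vec d j) $ i" by simp
    thus ?thesis using that M by auto
  qed
  hence "M = c \<cdot>\<^sub>m 1\<^sub>m d" using M by (intro eq_matI) auto
  thus ?thesis ..
qed

text \<open>For fixed \<open>i\<close> and \<open>j\<close> the sums are the entries of \<open>\<Sum>\<^sub>g R(g) E\<^sub>i\<^sub>j R(g\<^sup>-\<^sup>1)\<close>, where \<open>E\<^sub>i\<^sub>j\<close> is the matrix
unit. Substituting \<open>hg\<close> for \<open>g\<close> shows that this matrix commutes with the representation, so it is
scalar, and the scalar is found from the trace.\<close>

lemma schur_orthogonality: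
  assumes "a < d" "b < d" "i < d" "j < d"
  shows "(\<Sum>g\<in>carrier G. R g $$ (a, i) * R (inv g) $$ (j, b)) =
    (if a = b \<and> i = j then of_nat (Coset.order G) / of_nat d else 0)"
proof -
  define m where "m = (\<lambda>a b. \<Sum>g\<in>carrier G. R g $$ (a, i) * R (inv g) $$ (j, b))"
  define M where "M = mat d d (\<lambda>(a, b). m a b)"
  have M: "M \<in> carrier_mat d d" by (simp add: M_def)
  have comm: "R h * M = M * R h" if h: "h \<in> carrier G" for h
  proof (rule eq_matI)
    fix a b assume "a < dim_row (M * R h)" "b < dim_col (M * R h)"
    hence ab: "a < d" "b < d" using h M R_carrier[OF h] by auto
    have "(R h * M) $$ (a, b) = (\<Sum>k<d. R h $$ (a, k) * m k b)"
      using ab h M by (simp add: mat_mult_entry[of _ d]) (simp add: M_def)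
    also have "\<dots> = (\<Sum>g\<in>carrier G. (\<Sum>k<d. R h $$ (a, k) * R g $$ (k, i)) * R (inv g) $$ (j, b))"
      unfolding m_def sum_distrib_left sum_distrib_right by (subst sum.swap) (simp add: mult.assoc)
    also have "\<dots> = (\<Sum>g\<in>carrier G. R (h \<otimes> g) $$ (a, i) * R (inv g) $$ (j, b))"
      using assms ab h by (intro sum.cong) (auto simp: R_mult_entry)
    \<comment> \<open>The substitution of \<open>h\<^sup>-\<^sup>1 g\<close> for \<open>g\<close> moves \<open>h\<close> from the left to the right.\<close>
    also have "\<dots> = (\<Sum>g\<in>carrier G. R g $$ (a, i) * R (inv g \<otimes> h) $$ (j, b))"
      using h by (intro sum.reindex_bij_witness[of _ "\<lambda>g. inv h \<otimes> g" "\<lambda>g. h \<otimes> g"])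
        (auto simp: m_assoc[symmetric] inv_mult_group m_assoc)
    also have "\<dots> = (\<Sum>g\<in>carrier G. R g $$ (a, i) * (\<Sum>k<d. R (inv g) $$ (j, k) * R h $$ (k, b)))"
      using assms ab h by (intro sum.cong) (auto simp: R_mult_entry)
    also have "\<dots> = (\<Sum>k<d. m a k * R h $$ (k, b))"
      unfolding m_def sum_distrib_left sum_distrib_right by (subst sum.swap) (simp add: mult.assoc)
    also have "\<dots> = (M * R h) $$ (a, b)"
      using ab h M by (simp add: mat_mult_entry[of _ d]) (simp add: M_def)
    finally show "(R h * M) $$ (a, b) = (M * R h) $$ (a, b)" .
  qed (use M R_carrier[OF h] in auto)
  obtain c where c: "M = c \<cdot>\<^sub>m 1\<^sub>m d" using schur[OF M comm] by blast
  have mc: "m a b = (if a = b then c else 0)" if "a < d" "b < d" for a b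
    using that arg_cong[OF c, of "\<lambda>X. X $$ (a, b)"] by (auto simp: M_def split: if_splits)
  have "of_nat d * c = (\<Sum>a<d. m a a)" by (simp add: mc)
  also have "\<dots> = (\<Sum>g\<in>carrier G. \<Sum>a<d. R (inv g) $$ (j, a) * R g $$ (a, i))"
    unfolding m_def by (subst sum.swap) (simp add: mult.commute)
  also have "\<dots> = (\<Sum>g\<in>carrier G. R \<one> $$ (j, i))"
    using assms by (intro sum.cong) (auto simp flip: R_mult_entry)
  also have "\<dots> = (if i = j then of_nat (Coset.order G) else 0)"
    using assms by (simp add: R_one Coset.order_def)
  finally have "c = (if i = j then of_nat (Coset.order G) / of_nat d else 0)"
    using d_pos by (auto simp: field_simps)
  thus ?thesis using mc[OF assms(1,2)] by (simp add: m_def)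
qed

abbreviation "\<chi> \<equiv> character_of G d R"

lemma character_eq: "g \<in> carrier G \<Longrightarrow> \<chi> g = (\<Sum>i<d. R g $$ (i, i))"
  by (simp add: character_of_def)

lemma character_one: "\<chi> \<one> = of_nat d"
  by (simp add: character_eq R_one)

lemma character_mult:
  assumes "g \<in> carrier G" "h \<in> carrier G"
  shows "\<chi> (g \<otimes> h) = (\<Sum>a<d. \<Sum>i<d. R g $$ (a, i) * R h $$ (i, a))"
  using assms by (simp add: character_eq R_mult_entry)

lemma character_commute:
  assumes "g \<in> carrier G" "h \<in> carrier G"
  shows "\<chi> (g \<otimes> h) = \<chi> (h \<otimes> g)"
  unfolding character_mult[OF assms] character_mult[OF assms(2,1)]
  by (subst sum.swap) (simp add: mult.commute)

lemma character_conj: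
  assumes "g \<in> carrier G" "x \<in> carrier G"
  shows "\<chi> (g \<otimes> x \<otimes> inv g) = \<chi> x"
  using assms character_commute[of "g \<otimes> x" "inv g"] by (simp flip: m_assoc)

text \<open>The first orthogonality relation of \<open>\<chi>\<close> with itself, as \<open>\<chi>(g\<^sup>-\<^sup>1)\<close> is the complex conjugate of \<open>\<chi>(g)\<close>.
It is the sum of the orthogonality relations over all pairs of diagonal matrix entries.\<close>

lemma character_norm: "(\<Sum>g\<in>carrier G. \<chi> g * \<chi> (inv g)) = of_nat (Coset.order G)"
proof -
  have "(\<Sum>g\<in>carrier G. \<chi> g * \<chi> (inv g)) =
      (\<Sum>i<d. \<Sum>j<d. \<Sum>g\<in>carrier G. R g $$ (i, i) * R (inv g) $$ (j, j))"
    by (subst (2) sum.swap, subst sum.swap)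
      (simp add: character_eq sum_product sum.swap[of _ "carrier G"])
  also have "\<dots> = (\<Sum>i<d. \<Sum>j<d. if i = j then of_nat (Coset.order G) / of_nat d else 0)"
    by (intro sum.cong refl) (simp add: schur_orthogonality)
  also have "\<dots> = of_nat (Coset.order G)" using d_pos by simp
  finally show ?thesis .
qed

lemma sum_conj_entry:
  assumes x: "x \<in> carrier G" and ab: "a < d" "b < d"
  shows "(\<Sum>g\<in>carrier G. R (g \<otimes> x \<otimes> inv g) $$ (a, b)) =
    (if a = b then of_nat (Coset.order G) * \<chi> x / of_nat d else 0)"
proof -
  have "(\<Sum>g\<in>carrier G. R (g \<otimes> x \<otimes> inv g) $$ (a, b)) =
      (\<Sum>g\<in>carrier G. \<Sum>i<d. \<Sum>j<d. R x $$ (i, j) * (R g $$ (a, i) * R (inv g) $$ (j, b)))"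
  proof (intro sum.cong refl)
    fix g assume g: "g \<in> carrier G"
    have "R (g \<otimes> x \<otimes> inv g) $$ (a, b) = R (g \<otimes> (x \<otimes> inv g)) $$ (a, b)"
      using g x by (simp add: m_assoc)
    also have "\<dots> = (\<Sum>i<d. R g $$ (a, i) * (\<Sum>j<d. R x $$ (i, j) * R (inv g) $$ (j, b)))"
      using g x ab by (simp add: R_mult_entry)
    finally show "R (g \<otimes> x \<otimes> inv g) $$ (a, b) =
        (\<Sum>i<d. \<Sum>j<d. R x $$ (i, j) * (R g $$ (a, i) * R (inv g) $$ (j, b)))"
      by (simp add: sum_distrib_left mult_ac)
  qed
  also have "\<dots> = (\<Sum>i<d. \<Sum>j<d. \<Sum>g\<in>carrier G. R x $$ (i, j) * (R g $$ (a, i) * R (inv g) $$ (j, b)))"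
    by (subst sum.swap, intro sum.cong refl, subst sum.swap, rule refl)
  also have "\<dots> = (\<Sum>i<d. \<Sum>j<d. R x $$ (i, j) *
      (if a = b \<and> i = j then of_nat (Coset.order G) / of_nat d else 0))"
    using ab by (intro sum.cong refl) (simp add: schur_orthogonality flip: sum_distrib_left)
  also have "\<dots> = (if a = b then
      (\<Sum>i<d. \<Sum>j<d. if i = j then R x $$ (i, j) * (of_nat (Coset.order G) / of_nat d) else 0) else 0)"
    by (auto simp: if_distrib[of "(*) _"] cong: if_cong)
  also have "\<dots> = (if a = b then of_nat (Coset.order G) * \<chi> x / of_nat d else 0)"
    by (simp add: character_eq[OF x] sum_divide_distrib sum_distrib_left mult.commute)
  finally show ?thesis .
qed

text \<open>The sum of the matrices of all conjugates of \<open>x\<close> is a scalar matrix, so multiplying it by the matrix of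
\<open>y\<close> and taking the trace separates the two arguments. All multiplicative relations between character
ratios come from this identity.\<close>

lemma character_conj_sum:
  assumes x: "x \<in> carrier G" and y: "y \<in> carrier G"
  shows "(\<Sum>g\<in>carrier G. \<chi> (g \<otimes> x \<otimes> inv g \<otimes> y)) =
    of_nat (Coset.order G) * \<chi> x * \<chi> y / \<chi> \<one>"
proof -
  have "(\<Sum>g\<in>carrier G. \<chi> (g \<otimes> x \<otimes> inv g \<otimes> y)) =
      (\<Sum>g\<in>carrier G. \<Sum>a<d. \<Sum>i<d. R (g \<otimes> x \<otimes> inv g) $$ (a, i) * R y $$ (i, a))"
    using x y by (intro sum.cong refl) (simp add: character_mult)
  also have "\<dots> = (\<Sum>a<d. \<Sum>i<d. \<Sum>g\<in>carrier G. R (g \<otimes> x \<otimes> inv g) $$ (a, i) * R y $$ (i, a))"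
    by (subst sum.swap, intro sum.cong refl, subst sum.swap, rule refl)
  also have "\<dots> = (\<Sum>a<d. \<Sum>i<d. if a = i then of_nat (Coset.order G) * \<chi> x / of_nat d * R y $$ (i, a) else 0)"
    using x by (intro sum.cong refl) (simp add: sum_conj_entry flip: sum_distrib_right)
  also have "\<dots> = of_nat (Coset.order G) * \<chi> x * \<chi> y / \<chi> \<one>"
    by (simp add: character_one character_eq[OF y] sum_distrib_left sum_divide_distrib)
  finally show ?thesis .
qed

end

lemma Irr_cases:
  assumes "\<chi> \<in> Irr G" "group G" "finite (carrier G)"
  obtains d R where "irreducible_rep G d R" "\<chi> = character_of G d R"
  using assms unfolding Irr_def irreducible_rep_def irreducible_rep_axioms_def by auto

section \<open>Cycle decompositions and cycle types\<close>

definition perm_of_cycles :: "'a list list \<Rightarrow> 'a \<Rightarrow> 'a" where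
  "perm_of_cycles css = foldr (\<lambda>cs p. cycle_of_list cs \<circ> p) css id"

lemma perm_of_cycles_simps [simp]:
  "perm_of_cycles [] = id"
  "perm_of_cycles (cs # css) = cycle_of_list cs \<circ> perm_of_cycles css"
  by (simp_all add: perm_of_cycles_def)

lemma perm_of_cycles_outside: "x \<notin> set (concat css) \<Longrightarrow> perm_of_cycles css x = x"
  by (induction css) (auto simp: id_outside_supp)

lemma perm_of_cycles_on:
  assumes "distinct (concat css)" "cs \<in> set css" "x \<in> set cs"
  shows "perm_of_cycles css x = cycle_of_list cs x"
  using assms
proof (induction css)
  case (Cons es css)
  show ?case
  proof (cases "x \<in> set es")
    case True
    hence "x \<notin> set (concat css)" "cs = es" using Cons.prems by auto
    thus ?thesis using perm_of_cycles_outside[of x css] by simp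
  next
    case False
    hence cs: "cs \<in> set css" using Cons.prems by auto
    hence "perm_of_cycles css x = cycle_of_list cs x" using Cons by simp
    moreover have "cycle_of_list cs x \<in> set cs"
      using permutes_in_image[OF cycle_permutes[of cs], of x] Cons.prems by simp
    moreover from this have "cycle_of_list cs x \<notin> set es" using Cons.prems cs by auto
    ultimately show ?thesis by (simp add: id_outside_supp)
  qed
qed simp

text \<open>Fixed points appear as cycles of length one, so that the lengths of the cycles are all parts of the
cycle type of a permutation of \<open>S\<close>.\<close>

definition cycle_decomposition_of :: "'a list list \<Rightarrow> 'a set \<Rightarrow> ('a \<Rightarrow> 'a) \<Rightarrow> bool" where
  "cycle_decomposition_of css S p \<longleftrightarrow>
     distinct (concat css) \<and> [] \<notin> set css \<and> set (concat css) = S \<and> p = perm_of_cycles css"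

lemma cycle_decomposition_of_Cons:
  "cycle_decomposition_of (cs # css) S p \<longleftrightarrow>
    distinct cs \<and> cs \<noteq> [] \<and> set cs \<subseteq> S \<and>
    (\<exists>q. cycle_decomposition_of css (S - set cs) q \<and> p = cycle_of_list cs \<circ> q)"
  by (auto simp: cycle_decomposition_of_def)

text \<open>Disjoint cycles commute; here this follows by evaluating both products at each point, where only the
cycle through that point acts.\<close>

lemma cycle_decomposition_of_reorder:
  assumes "cycle_decomposition_of css S p" "mset css = mset dss"
  shows "cycle_decomposition_of dss S p"
proof -
  have css: "distinct (concat css)" "[] \<notin> set css" "set (concat css) = S" "p = perm_of_cycles css"
    using assms(1) by (auto simp: cycle_decomposition_of_def)
  have "mset (concat css) = mset (concat dss)"
    using assms(2) by (metis mset_concat mset_map sum_mset_sum_list)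
  hence d: "distinct (concat dss)" "set (concat css) = set (concat dss)"
    using css(1) by - (metis mset_eq_imp_distinct_iff, metis mset_eq_setD)
  have s: "set css = set dss" using assms(2) by (rule mset_eq_setD)
  have "perm_of_cycles css = perm_of_cycles dss"
  proof
    fix x
    show "perm_of_cycles css x = perm_of_cycles dss x"
    proof (cases "x \<in> set (concat css)")
      case True
      then obtain cs where "cs \<in> set css" "x \<in> set cs" by auto
      thus ?thesis using perm_of_cycles_on css(1) d(1) s by metis
    next
      case False
      thus ?thesis using d(2) perm_of_cycles_outside by metis
    qed
  qed
  thus ?thesis using css d s by (auto simp: cycle_decomposition_of_def)
qed

lemma cycle_decomposition_of_exists:
  assumes "p permutes S" "finite S"
  shows "\<exists>css. cycle_decomposition_of css S p"
  using cycle_decomposition[OF assms]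
proof induction
  case empty
  show ?case by (rule exI[of _ "[]"]) (simp add: cycle_decomposition_of_def id_def)
next
  case (comp I p cs)
  then obtain css where css: "cycle_decomposition_of css I p" by blast
  show ?case
  proof (cases "cs = []")
    case True
    thus ?thesis using css by auto
  next
    case False
    moreover have "set cs \<union> I - set cs = I" using comp by blast
    ultimately have "cycle_decomposition_of (cs # css) (set cs \<union> I) (cycle_of_list cs \<circ> p)"
      using comp css unfolding cycle_decomposition_of_Cons by auto
    thus ?thesis by blast
  qed
qed

lemma cycle_funpow_nth:
  assumes "distinct cs" "i < length cs"
  shows "(cycle_of_list cs ^^ k) (cs ! i) = cs ! ((k + i) mod length cs)"
  using cyclic_rotation[OF assms(1), of k] assms(2) by (metis nth_map nth_rotate)

text \<open>On \<open>cs\<close> the powers of the permutation are rotations of the list.\<close>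

lemma orbit_perm_of_cycles:
  assumes "distinct (concat css)" "cs \<in> set css" "x \<in> set cs"
  shows "orbit (perm_of_cycles css) x = set cs"
proof -
  have cs: "distinct cs" using assms by (auto simp: distinct_concat_iff)
  have pow: "(perm_of_cycles css ^^ k) x = (cycle_of_list cs ^^ k) x \<and> (cycle_of_list cs ^^ k) x \<in> set cs" for k
  proof (induction k)
    case (Suc k)
    thus ?case
      using perm_of_cycles_on[OF assms(1,2)] permutes_in_image[OF cycle_permutes[of cs]] by simp
  qed (use assms in auto)
  obtain i where i: "i < length cs" "x = cs ! i" using assms(3) by (metis in_set_conv_nth)
  have "orbit (perm_of_cycles css) x = {cs ! ((k + i) mod length cs) | k. 0 < k}"
    unfolding orbit_altdef using pow i cycle_funpow_nth[OF cs i(1)] by auto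
  also have "\<dots> = set cs"
  proof
    show "set cs \<subseteq> {cs ! ((k + i) mod length cs) | k. 0 < k}"
    proof
      fix y assume "y \<in> set cs"
      then obtain j where j: "j < length cs" "y = cs ! j" by (metis in_set_conv_nth)
      \<comment> \<open>From \<open>cs ! i\<close> it takes \<open>j - i\<close> steps to \<open>cs ! j\<close>; adding a full turn makes the number positive.\<close>
      have "(j + length cs - i + i) mod length cs = j" "0 < j + length cs - i"
        using i(1) j(1) by auto
      thus "y \<in> {cs ! ((k + i) mod length cs) | k. 0 < k}"
        using j(2) by (metis (mono_tags, lifting) mem_Collect_eq)
    qed
  next
    have "length cs > 0" using i(1) by linarith
    thus "{cs ! ((k + i) mod length cs) | k. 0 < k} \<subseteq> set cs" by auto
  qed
  finally show ?thesis .
qed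

lemma cycle_type_eq:
  assumes "cycle_decomposition_of css {1..n} p"
  shows "cycle_type n p = mset (map length css)"
proof -
  have css: "distinct (concat css)" "[] \<notin> set css" "set (concat css) = {1..n}" "p = perm_of_cycles css"
    using assms by (auto simp: cycle_decomposition_of_def)
  have dist: "distinct css" using css(1,2) by (simp add: distinct_concat_iff)
  have inj: "inj_on set (set css)"
  proof (rule inj_onI)
    fix cs ds assume *: "cs \<in> set css" "ds \<in> set css" "set cs = set ds"
    have "cs \<noteq> []" using *(1) css(2) by metis
    hence "set cs \<inter> set ds \<noteq> {}" using *(3) by auto
    thus "cs = ds" using css(1) * unfolding distinct_concat_iff by blast
  qed
  have "orbit p ` {1..n} = set ` set css"
  proof
    show "orbit p ` {1..n} \<subseteq> set ` set css"
      unfolding css(3)[symmetric] using orbit_perm_of_cycles[OF css(1)] css(4) by auto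
    show "set ` set css \<subseteq> orbit p ` {1..n}"
    proof
      fix A assume "A \<in> set ` set css"
      then obtain cs where cs: "cs \<in> set css" "A = set cs" by blast
      then obtain x where x: "x \<in> set cs" using css(2) by (metis last_in_set)
      hence "A = orbit p x" using orbit_perm_of_cycles[OF css(1) cs(1)] css(4) cs(2) by simp
      moreover have "x \<in> {1..n}" using x cs(1) css(3) by auto
      ultimately show "A \<in> orbit p ` {1..n}" by blast
    qed
  qed
  hence "cycle_type n p = image_mset card (image_mset set (mset css))"
    by (simp add: cycle_type_def mset_set_set[OF dist, symmetric] image_mset_mset_set[OF inj])
  also have "\<dots> = image_mset length (mset css)"
    using css(1) by (auto simp: multiset.map_comp distinct_concat_iff distinct_card intro!: image_mset_cong)
  finally show ?thesis by simp
qed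

text \<open>This arranges the cycles of a second permutation so that their lengths match those of a first one.\<close>

lemma image_mset_eq_mset_lift:
  assumes "image_mset f M = mset ys"
  shows "\<exists>xs. mset xs = M \<and> map f xs = ys"
  using assms
proof (induction ys arbitrary: M)
  case (Cons y ys)
  then obtain N a where N: "M = add_mset a N" "f a = y" "image_mset f N = mset ys"
    using msed_map_invR[of f M y "mset ys"] by auto
  then obtain xs where "mset xs = N" "map f xs = ys" using Cons.IH by blast
  thus ?case using N by (intro exI[of _ "a # xs"]) simp
qed simp

lemma permutes_between_distinct_lists:
  assumes "distinct xs" "distinct ys" "set xs = set ys"
  shows "\<exists>g. g permutes set xs \<and> map g xs = ys"
proof -
  have len: "length xs = length ys" using assms by (metis distinct_card)
  define g where "g x = (if x \<in> set xs then ys ! inv_into {..<length xs} (nth xs) x else x)" for x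
  have bx: "bij_betw (nth xs) {..<length xs} (set xs)"
    and by': "bij_betw (nth ys) {..<length xs} (set xs)"
    using assms len by (simp_all add: bij_betw_nth)
  have "bij_betw (nth ys \<circ> inv_into {..<length xs} (nth xs)) (set xs) (set xs)"
    by (rule bij_betw_trans[OF bij_betw_inv_into[OF bx] by'])
  hence "bij_betw g (set xs) (set xs)"
    by (rule bij_betw_cong[THEN iffD1, rotated]) (simp add: g_def)
  hence "g permutes set xs" by (rule bij_imp_permutes) (simp add: g_def)
  moreover have "map g xs = ys"
    using len bij_betw_inv_into_left[OF bx] by (intro nth_equalityI) (auto simp: g_def)
  ultimately show ?thesis by blast
qed

lemma perm_of_cycles_conj:
  assumes "bij g" "\<And>cs. cs \<in> set css \<Longrightarrow> distinct cs"
  shows "g \<circ> perm_of_cycles css \<circ> inv' g = perm_of_cycles (map (map g) css)"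
  using assms(2)
proof (induction css)
  case Nil
  show ?case using assms(1) by (auto simp: fun_eq_iff surj_f_inv_f[OF bij_is_surj])
next
  case (Cons cs css)
  have "g \<circ> perm_of_cycles (cs # css) \<circ> inv' g =
      (g \<circ> cycle_of_list cs \<circ> inv' g) \<circ> (g \<circ> perm_of_cycles css \<circ> inv' g)"
    using assms(1) by (simp add: fun_eq_iff bij_is_inj)
  also have "g \<circ> cycle_of_list cs \<circ> inv' g = cycle_of_list (map g cs)"
    using conjugation_of_cycle[OF _ assms(1)] Cons.prems by simp
  also have "g \<circ> perm_of_cycles css \<circ> inv' g = perm_of_cycles (map (map g) css)"
    by (rule Cons.IH) (simp add: Cons.prems)
  finally show ?case by simp
qed

text \<open>After the cycles have been matched by length, the concatenated cycle lists are two enumerations of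
\<open>{1..n}\<close>, and the bijection between them conjugates one permutation into the other.\<close>

lemma conjugate_if_cycle_type_eq:
  assumes p: "p permutes {1..n}" and q: "q permutes {1..n}" and eq: "cycle_type n p = cycle_type n q"
  shows "\<exists>g. g permutes {1..n} \<and> g \<circ> p \<circ> inv' g = q"
proof -
  obtain css where css: "cycle_decomposition_of css {1..n} p"
    using cycle_decomposition_of_exists[OF p] by auto
  obtain ess where ess: "cycle_decomposition_of ess {1..n} q"
    using cycle_decomposition_of_exists[OF q] by auto
  have "image_mset length (mset ess) = mset (map length css)"
    using eq cycle_type_eq[OF css] cycle_type_eq[OF ess] by simp
  then obtain dss where "mset dss = mset ess" and len: "map length dss = map length css"
    using image_mset_eq_mset_lift by blast
  hence dss: "cycle_decomposition_of dss {1..n} q"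
    using cycle_decomposition_of_reorder[OF ess] by simp
  obtain g where g: "g permutes {1..n}" "map g (concat css) = concat dss"
    using permutes_between_distinct_lists[of "concat css" "concat dss"] css dss
    by (auto simp: cycle_decomposition_of_def)
  have l: "length css = length dss" using arg_cong[OF len, of length] by simp
  have "map (map g) css = dss"
  proof (rule concat_injective)
    show "concat (map (map g) css) = concat dss" using g(2) by (simp add: map_concat)
    show "length (map (map g) css) = length dss" using l by simp
    show "\<forall>(x, y)\<in>set (zip (map (map g) css) dss). length x = length y"
      using len l by (auto simp: in_set_zip dest: map_eq_imp_length_eq) (metis length_map nth_map)
  qed
  moreover have "g \<circ> perm_of_cycles css \<circ> inv' g = perm_of_cycles (map (map g) css)"
    using css permutes_bij[OF g(1)]
    by (intro perm_of_cycles_conj) (auto simp: cycle_decomposition_of_def distinct_concat_iff)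
  ultimately show ?thesis using g(1) css dss by (auto simp: cycle_decomposition_of_def)
qed

lemma cycle_type_is_partition:
  assumes "p permutes {1..n}"
  shows "is_partition_of (cycle_type n p) n"
proof -
  obtain css where css: "cycle_decomposition_of css {1..n} p"
    using cycle_decomposition_of_exists[OF assms] by auto
  have "sum_list (map length css) = card (set (concat css))"
    using css by (subst distinct_card) (auto simp: cycle_decomposition_of_def length_concat)
  hence "sum_list (map length css) = n" using css by (simp add: cycle_decomposition_of_def)
  moreover have "\<forall>cs\<in>set css. length cs \<ge> 1"
    using css by (auto simp: cycle_decomposition_of_def Suc_le_eq)
  ultimately show ?thesis
    unfolding is_partition_of_def cycle_type_eq[OF css] sum_mset_sum_list by auto
qed

lemma cycle_type_extend_cycle:
  assumes p: "p permutes {1..m}" and r: "r \<ge> 1"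
  shows "cycle_type (m + r) (cycle_of_list [m+1..<m+r+1] \<circ> p) = add_mset r (cycle_type m p)"
proof -
  obtain css where css: "cycle_decomposition_of css {1..m} p"
    using cycle_decomposition_of_exists[OF p] by auto
  define cs where "cs = [m+1..<m+r+1]"
  have "distinct cs" "cs \<noteq> []" "set cs \<subseteq> {1..m + r}" and len: "length cs = r"
    using r by (auto simp: cs_def)
  moreover have "{1..m + r} - set cs = {1..m}" by (auto simp: cs_def)
  ultimately have "cycle_decomposition_of (cs # css) {1..m + r} (cycle_of_list cs \<circ> p)"
    using css unfolding cycle_decomposition_of_Cons by simp blast
  from cycle_type_eq[OF this] cycle_type_eq[OF css] len show ?thesis by (simp add: cs_def)
qed

lemma cycle_type_extend:
  assumes "p permutes {1..m}" "m \<le> n"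
  shows "cycle_type n p = cycle_type m p + replicate_mset (n - m) 1"
proof -
  have "cycle_type (m + k) p = cycle_type m p + replicate_mset k 1" for k
  proof (induction k)
    case (Suc k)
    have "p permutes {1..m + k}" using assms(1) by (rule permutes_subset) auto
    from cycle_type_extend_cycle[OF this, of 1] Suc show ?case by simp
  qed simp
  from this[of "n - m"] show ?thesis using assms(2) by simp
qed

lemma cycle_type_surj:
  assumes "is_partition_of \<mu> m"
  shows "\<exists>p. p permutes {1..m} \<and> cycle_type m p = \<mu>"
  using assms
proof (induction \<mu> arbitrary: m)
  case empty
  hence "m = 0" by (simp add: is_partition_of_def)
  moreover have "cycle_type 0 id = {#}" by (simp add: cycle_type_def)
  ultimately show ?case using permutes_id by blast
next
  case (add r \<mu>)
  hence "is_partition_of \<mu> (sum_mset \<mu>)" by (simp add: is_partition_of_def)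
  then obtain p where p: "p permutes {1..sum_mset \<mu>}" "cycle_type (sum_mset \<mu>) p = \<mu>"
    using add.IH by blast
  have m: "m = sum_mset \<mu> + r" and r: "r \<ge> 1" using add.prems by (auto simp: is_partition_of_def)
  have "cycle_of_list [sum_mset \<mu> + 1..<sum_mset \<mu> + r + 1] permutes {1..m}"
    using cycle_permutes by (rule permutes_subset) (auto simp: m)
  moreover have "p permutes {1..m}" using p(1) by (rule permutes_subset) (auto simp: m)
  ultimately have "cycle_of_list [sum_mset \<mu> + 1..<sum_mset \<mu> + r + 1] \<circ> p permutes {1..m}"
    by (rule permutes_compose[rotated])
  thus ?case using cycle_type_extend_cycle[OF p(1) r] p(2) m by metis
qed

lemma cycle_decomposition_of_front:
  assumes "cycle_decomposition_of css S p" "a \<in> S"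
  shows "\<exists>xs rest. cycle_decomposition_of ((a # xs) # rest) S p"
proof -
  obtain cs where cs: "cs \<in> set css" "a \<in> set cs"
    using assms by (auto simp: cycle_decomposition_of_def)
  obtain us vs where split: "cs = us @ a # vs" using cs(2) by (meson split_list)
  obtain rest where "mset css = mset (cs # rest)"
    using cs(1) by (metis ex_mset insert_DiffM mset.simps(2) set_mset_mset)
  hence "cycle_decomposition_of (cs # rest) S p"
    using cycle_decomposition_of_reorder[OF assms(1)] by blast
  moreover have "cycle_of_list cs = cycle_of_list (a # vs @ us)" if "distinct cs"
    using cycle_of_list_rotate_independent[OF that, of "length us"] by (simp add: split rotate_append)
  moreover have "set cs = set (a # vs @ us)" "distinct cs \<longleftrightarrow> distinct (a # vs @ us)"
    by (auto simp: split)
  ultimately have "cycle_decomposition_of ((a # vs @ us) # rest) S p"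
    unfolding cycle_decomposition_of_Cons by auto
  thus ?thesis by blast
qed

text \<open>Read from left to right, a transposition of two points of one cycle cuts that cycle; as transpositions
are involutions, it also joins two cycles.\<close>

lemma cycle_split:
  assumes "distinct (a # xs @ b # ys)"
  shows "cycle_of_list (a # xs @ b # ys) =
    transpose a b \<circ> cycle_of_list (a # xs) \<circ> cycle_of_list (b # ys)"
  using assms
proof (induction xs arbitrary: a)
  case (Cons x xs)
  have "transpose a x (transpose x b z) = transpose a b (transpose a x z)" for z
    using Cons.prems by (auto simp: transpose_def)
  moreover have "cycle_of_list (x # xs @ b # ys) =
      transpose x b \<circ> cycle_of_list (x # xs) \<circ> cycle_of_list (b # ys)"
    by (rule Cons.IH) (use Cons.prems in simp)
  ultimately show ?case by (simp add: fun_eq_iff)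
qed simp

text \<open>A transposition cuts a cycle if its points lie on the same cycle and joins two cycles otherwise.\<close>

lemma size_cycle_type_transpose:
  assumes p: "p permutes {1..n}" and ab: "a \<in> {1..n}" "b \<in> {1..n}" "a \<noteq> b"
  shows "size (cycle_type n (transpose a b \<circ> p)) = Suc (size (cycle_type n p)) \<or>
    size (cycle_type n p) = Suc (size (cycle_type n (transpose a b \<circ> p)))"
proof -
  obtain css where "cycle_decomposition_of css {1..n} p"
    using cycle_decomposition_of_exists[OF p] by auto
  then obtain xs rest where dec: "cycle_decomposition_of ((a # xs) # rest) {1..n} p"
    using cycle_decomposition_of_front ab(1) by meson
  then obtain q where q: "cycle_decomposition_of rest ({1..n} - set (a # xs)) q"
    and p_eq: "p = cycle_of_list (a # xs) \<circ> q" and axs: "distinct (a # xs)" "set (a # xs) \<subseteq> {1..n}"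
    unfolding cycle_decomposition_of_Cons by blast
  have invol: "transpose a b \<circ> (transpose a b \<circ> f) = f" for f :: "nat \<Rightarrow> nat"
    by (simp add: fun_eq_iff)
  show ?thesis
  proof (cases "b \<in> set xs")
    case True
    then obtain us vs where xs: "xs = us @ b # vs" by (meson split_list)
    have "transpose a b \<circ> p = cycle_of_list (a # us) \<circ> (cycle_of_list (b # vs) \<circ> q)"
      using cycle_split[of a us b vs] axs by (simp add: p_eq xs comp_assoc invol)
    moreover have "{1..n} - set (a # us) - set (b # vs) = {1..n} - set (a # xs)"
      by (auto simp: xs)
    ultimately have "cycle_decomposition_of ((a # us) # (b # vs) # rest) {1..n} (transpose a b \<circ> p)"
      using q axs unfolding cycle_decomposition_of_Cons by (auto simp: xs)
    from cycle_type_eq[OF this] cycle_type_eq[OF dec] show ?thesis by simp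
  next
    case False
    hence "b \<in> {1..n} - set (a # xs)" using ab by auto
    then obtain ys rest' where q': "cycle_decomposition_of ((b # ys) # rest') ({1..n} - set (a # xs)) q"
      using cycle_decomposition_of_front[OF q] by blast
    then obtain t where t: "cycle_decomposition_of rest' ({1..n} - set (a # xs) - set (b # ys)) t"
      "q = cycle_of_list (b # ys) \<circ> t" "distinct (b # ys)" "set (b # ys) \<subseteq> {1..n} - set (a # xs)"
      unfolding cycle_decomposition_of_Cons by blast
    have dec': "cycle_decomposition_of ((a # xs) # (b # ys) # rest') {1..n} p"
      using q' p_eq axs unfolding cycle_decomposition_of_Cons[of "a # xs"] by blast
    have dist: "distinct (a # xs @ b # ys)" using axs t(3,4) by auto
    have "transpose a b \<circ> p = cycle_of_list (a # xs @ b # ys) \<circ> t"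
      using cycle_split[OF dist] by (simp add: p_eq t(2) comp_assoc)
    moreover have "{1..n} - set (a # xs) - set (b # ys) = {1..n} - set (a # xs @ b # ys)" by auto
    ultimately have "cycle_decomposition_of ((a # xs @ b # ys) # rest') {1..n} (transpose a b \<circ> p)"
      using dist axs t(1,4) unfolding cycle_decomposition_of_Cons by auto
    from cycle_type_eq[OF this] cycle_type_eq[OF dec'] show ?thesis by simp
  qed
qed

lemma part_norm_add_size:
  assumes "\<And>k. k \<in># \<mu> \<Longrightarrow> k \<ge> 1"
  shows "part_norm \<mu> + size \<mu> = sum_mset \<mu>"
  using assms
proof (induction \<mu>)
  case (add k \<mu>)
  have "k \<ge> 1" using add.prems by simp
  hence "k = 1 \<or> k \<ge> 2" by linarith
  thus ?case using add by (auto simp: part_norm_def)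
qed (simp add: part_norm_def)

lemma part_norm_cycle_type:
  assumes "p permutes {1..n}"
  shows "part_norm (cycle_type n p) + size (cycle_type n p) = n"
  using cycle_type_is_partition[OF assms] part_norm_add_size by (auto simp: is_partition_of_def)

text \<open>Since \<open>part_norm\<close> is \<open>n\<close> minus the number of cycles, each of the \<open>length cs - 1\<close> transpositions of the cycle
changes it by exactly one.\<close>

lemma part_norm_cycle_compose:
  assumes p: "p permutes {1..n}" and cs: "distinct cs" "cs \<noteq> []" "set cs \<subseteq> {1..n}"
  shows "part_norm (cycle_type n (cycle_of_list cs \<circ> p)) \<le> length cs - 1 + part_norm (cycle_type n p) \<and>
    [part_norm (cycle_type n (cycle_of_list cs \<circ> p)) = length cs - 1 + part_norm (cycle_type n p)] (mod 2)"
  using cs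
proof (induction cs rule: cycle_of_list.induct)
  case (1 i j cs)
  let ?q = "cycle_of_list (j # cs) \<circ> p"
  have prems: "distinct (j # cs)" "j # cs \<noteq> []" "set (j # cs) \<subseteq> {1..n}"
    using "1.prems" by auto
  have q: "?q permutes {1..n}"
    using p permutes_subset[OF cycle_permutes prems(3)] by (rule permutes_compose)
  have "transpose i j permutes {1..n}" using "1.prems" by (intro permutes_swap_id) auto
  with q have q': "transpose i j \<circ> ?q permutes {1..n}" by (rule permutes_compose)
  have arith: "a' \<le> Suc l - 1 + b \<and> [a' = Suc l - 1 + b] (mod 2)"
    if hyps: "a' + s' = n" "a + s = n" "s' = Suc s \<or> s = Suc s'" "a \<le> l - 1 + b \<and> [a = l - 1 + b] (mod 2)" "l \<ge> 1"
    for a a' b s s' l :: nat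
  proof -
    obtain k where k: "l = Suc k" using hyps(5) by (cases l) auto
    have "a = Suc a' \<or> a' = Suc a" using hyps(1-3) by linarith
    thus ?thesis using hyps(4) by (auto simp: k cong_def mod2_eq_if split: if_splits)
  qed
  have "size (cycle_type n (transpose i j \<circ> ?q)) = Suc (size (cycle_type n ?q)) \<or>
      size (cycle_type n ?q) = Suc (size (cycle_type n (transpose i j \<circ> ?q)))"
    using "1.prems" by (intro size_cycle_type_transpose[OF q]) auto
  note step = arith[OF part_norm_cycle_type[OF q'] part_norm_cycle_type[OF q] this "1.IH"[OF prems]]
  have eq: "cycle_of_list (i # j # cs) \<circ> p = transpose i j \<circ> ?q" by (simp add: comp_assoc)
  have "length (i # j # cs) = Suc (length (j # cs))" "1 \<le> length (j # cs)" by simp_all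
  with step show ?case unfolding eq by metis
qed (auto simp: cong_def)

section \<open>Polynomials with coefficients regular at large integers and at infinity\<close>

text \<open>The reduced denominator divides every denominator, so any representation as a fraction may be used for
evaluation at a point that is not a root of its denominator.\<close>

lemma ratfun_eval_fract:
  assumes f: "f = to_fract p / to_fract q" and q: "poly q x \<noteq> 0"
  shows "ratfun_defined_at f x \<and> ratfun_eval f x = poly p x / poly q x"
proof -
  define a b where "a = fst (quot_of_fract f)" and "b = snd (quot_of_fract f)"
  have cop: "coprime a b" and b0: "b \<noteq> 0" by (auto simp: a_def b_def coprime_quot_of_fract)
  have "f = to_fract a / to_fract b"
    using Fract_quot_of_fract[of f] by (simp only: a_def b_def Fract_conv_to_fract)
  moreover have "q \<noteq> 0" using q by auto
  ultimately have "to_fract p * to_fract b = to_fract a * to_fract q"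
    using f b0 by (simp add: field_simps)
  hence eq: "p * b = a * q" by (metis to_fract_mult to_fract_eq_iff)
  hence "b dvd q" using cop by (metis coprime_commute coprime_dvd_mult_right_iff dvd_triv_right)
  then obtain k where "q = b * k" by blast
  hence b: "poly b x \<noteq> 0" using q by auto
  have "poly p x * poly b x = poly a x * poly q x" using arg_cong[OF eq, of "\<lambda>r. poly r x"] by simp
  hence "poly a x / poly b x = poly p x / poly q x" using b q by (simp add: field_simps)
  thus ?thesis using b by (simp add: ratfun_defined_at_def ratfun_eval_def a_def b_def)
qed

text \<open>These rational functions form a ring: they are the ones that have no pole at an integer \<open>n \<ge> S\<close> and
none at infinity.\<close>

definition regular_coeff :: "nat \<Rightarrow> ratfun \<Rightarrow> bool" where
  "regular_coeff S f \<longleftrightarrow> (\<exists>p q. (\<forall>n\<ge>S. poly q (of_nat n) \<noteq> 0) \<and> degree p \<le> degree q \<and>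
     f = to_fract p / to_fract q)"

lemma regular_coeffI:
  assumes "\<And>n. n \<ge> S \<Longrightarrow> poly q (of_nat n) \<noteq> 0" "degree p \<le> degree q" "f = to_fract p / to_fract q"
  shows "regular_coeff S f"
  using assms unfolding regular_coeff_def by blast

lemma regular_coeffD:
  assumes "regular_coeff S f"
  shows "\<exists>p q. (\<forall>n\<ge>S. poly q (of_nat n) \<noteq> 0) \<and> degree p \<le> degree q \<and> q \<noteq> 0 \<and>
    f = to_fract p / to_fract q"
  using assms unfolding regular_coeff_def by (metis order_refl poly_0)

lemma regular_coeff_defined: "regular_coeff S f \<Longrightarrow> n \<ge> S \<Longrightarrow> ratfun_defined_at f (of_nat n)"
  using ratfun_eval_fract unfolding regular_coeff_def by blast

lemma regular_coeff_mono: "regular_coeff S f \<Longrightarrow> S \<le> S' \<Longrightarrow> regular_coeff S' f"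
  unfolding regular_coeff_def by (blast intro: order_trans)

lemma regular_coeff_0 [simp]: "regular_coeff S 0"
  by (rule regular_coeffI[of _ 1 0]) auto

lemma regular_coeff_1 [simp]: "regular_coeff S 1"
  by (rule regular_coeffI[of _ 1 1]) auto

lemma regular_coeff_add:
  assumes "regular_coeff S f" "regular_coeff S g"
  shows "regular_coeff S (f + g)"
    and "n \<ge> S \<Longrightarrow> ratfun_eval (f + g) (of_nat n) = ratfun_eval f (of_nat n) + ratfun_eval g (of_nat n)"
proof -
  obtain p q where f: "\<forall>n\<ge>S. poly q (of_nat n) \<noteq> 0" "degree p \<le> degree q" "q \<noteq> 0"
    "f = to_fract p / to_fract q" using regular_coeffD[OF assms(1)] by blast
  obtain p' q' where g: "\<forall>n\<ge>S. poly q' (of_nat n) \<noteq> 0" "degree p' \<le> degree q'" "q' \<noteq> 0"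
    "g = to_fract p' / to_fract q'" using regular_coeffD[OF assms(2)] by blast
  have eq: "f + g = to_fract (p * q' + p' * q) / to_fract (q * q')"
    using f(3,4) g(3,4) by (simp add: add_frac_eq)
  have "degree (p * q' + p' * q) \<le> degree q + degree q'"
    using f(2) g(2) degree_mult_le[of p q'] degree_mult_le[of p' q] by (intro degree_add_le) auto
  hence "degree (p * q' + p' * q) \<le> degree (q * q')" using f(3) g(3) by (simp add: degree_mult_eq)
  thus "regular_coeff S (f + g)"
    using eq f(1) g(1) by (intro regular_coeffI[of S "q * q'"]) auto
  assume n: "n \<ge> S"
  have fn: "poly q (of_nat n) \<noteq> 0" and gn: "poly q' (of_nat n) \<noteq> 0" using f(1) g(1) n by auto
  hence "poly (q * q') (of_nat n) \<noteq> 0" by simp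
  thus "ratfun_eval (f + g) (of_nat n) = ratfun_eval f (of_nat n) + ratfun_eval g (of_nat n)"
    using ratfun_eval_fract[OF eq, of "of_nat n"] ratfun_eval_fract[OF f(4) fn]
      ratfun_eval_fract[OF g(4) gn] fn gn by (simp add: add_frac_eq)
qed

lemma regular_coeff_mult:
  assumes "regular_coeff S f" "regular_coeff S g"
  shows "regular_coeff S (f * g)"
    and "n \<ge> S \<Longrightarrow> ratfun_eval (f * g) (of_nat n) = ratfun_eval f (of_nat n) * ratfun_eval g (of_nat n)"
proof -
  obtain p q where f: "\<forall>n\<ge>S. poly q (of_nat n) \<noteq> 0" "degree p \<le> degree q" "q \<noteq> 0"
    "f = to_fract p / to_fract q" using regular_coeffD[OF assms(1)] by blast
  obtain p' q' where g: "\<forall>n\<ge>S. poly q' (of_nat n) \<noteq> 0" "degree p' \<le> degree q'" "q' \<noteq> 0"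
    "g = to_fract p' / to_fract q'" using regular_coeffD[OF assms(2)] by blast
  have eq: "f * g = to_fract (p * p') / to_fract (q * q')"
    using f(3,4) g(3,4) by simp
  have "degree (p * p') \<le> degree (q * q')"
    using f(2,3) g(2,3) degree_mult_le[of p p'] by (simp add: degree_mult_eq)
  thus "regular_coeff S (f * g)"
    using eq f(1) g(1) by (intro regular_coeffI[of S "q * q'"]) auto
  assume n: "n \<ge> S"
  have fn: "poly q (of_nat n) \<noteq> 0" and gn: "poly q' (of_nat n) \<noteq> 0" using f(1) g(1) n by auto
  hence "poly (q * q') (of_nat n) \<noteq> 0" by simp
  thus "ratfun_eval (f * g) (of_nat n) = ratfun_eval f (of_nat n) * ratfun_eval g (of_nat n)"
    using ratfun_eval_fract[OF eq, of "of_nat n"] ratfun_eval_fract[OF f(4) fn]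
      ratfun_eval_fract[OF g(4) gn] fn gn by simp
qed

lemma ratfun_eval_1 [simp]: "ratfun_eval 1 x = 1"
  by (simp add: ratfun_eval_def)

lemma ratfun_eval_0 [simp]: "ratfun_eval 0 x = 0"
  by (simp add: ratfun_eval_def)

lemma regular_coeff_degree_le:
  assumes "regular_coeff S f" "f = to_fract p / to_fract q" "q \<noteq> 0"
  shows "degree p \<le> degree q"
proof (cases "p = 0")
  case False
  obtain a b where ab: "degree a \<le> degree b" "b \<noteq> 0" "f = to_fract a / to_fract b"
    using regular_coeffD[OF assms(1)] by blast
  have "to_fract p * to_fract b = to_fract a * to_fract q"
    using ab assms(2,3) by (simp add: field_simps)
  hence eq: "p * b = a * q" by (metis to_fract_mult to_fract_eq_iff)
  hence "a \<noteq> 0" using False ab(2) by auto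
  hence "degree p + degree b = degree a + degree q"
    using arg_cong[OF eq, of degree] False ab(2) assms(3) by (simp add: degree_mult_eq)
  thus ?thesis using ab(1) by linarith
qed simp

text \<open>The variable \<open>t\<^sub>(\<^sub>r\<^sub>)\<close> has weight \<open>\<parallel>(r)\<parallel> = r - 1\<close> and, in \<open>mono_size\<close>, size \<open>supp((r)) = r\<close>.\<close>

definition mono_weight :: "(nat \<Rightarrow>\<^sub>0 nat) \<Rightarrow> nat" where
  "mono_weight b = (\<Sum>r\<in>Poly_Mapping.keys b. Poly_Mapping.lookup b r * (r - 1))"

definition mono_size :: "(nat \<Rightarrow>\<^sub>0 nat) \<Rightarrow> nat" where
  "mono_size b = (\<Sum>r\<in>Poly_Mapping.keys b. Poly_Mapping.lookup b r * r)"

definition mono_eval :: "(nat \<Rightarrow>\<^sub>0 nat) \<Rightarrow> (nat \<Rightarrow> complex) \<Rightarrow> complex" where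
  "mono_eval b t = (\<Prod>r\<in>Poly_Mapping.keys b. t r ^ Poly_Mapping.lookup b r)"

lemma mono_over_superset:
  assumes "finite K" "Poly_Mapping.keys b \<subseteq> K"
  shows "mono_weight b = (\<Sum>r\<in>K. Poly_Mapping.lookup b r * (r - 1))"
    and "mono_size b = (\<Sum>r\<in>K. Poly_Mapping.lookup b r * r)"
    and "mono_eval b t = (\<Prod>r\<in>K. t r ^ Poly_Mapping.lookup b r)"
  unfolding mono_weight_def mono_size_def mono_eval_def
  using assms by (auto intro!: sum.mono_neutral_left prod.mono_neutral_left simp: in_keys_iff)

lemma mono_times_var:
  defines "m \<equiv> \<lambda>r. Poly_Mapping.single r (1::nat)"
  shows "mono_weight (b + m r) = mono_weight b + (r - 1)"
    and "mono_size (b + m r) = mono_size b + r"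
    and "mono_eval (b + m r) t = t r * mono_eval b t"
    and "Poly_Mapping.keys (b + m r) \<subseteq> insert r (Poly_Mapping.keys b)"
proof -
  let ?K = "insert r (Poly_Mapping.keys b)"
  show sub: "Poly_Mapping.keys (b + m r) \<subseteq> ?K"
    using Poly_Mapping.keys_add[of b "m r"] by (auto simp: m_def)
  have fin: "finite ?K" by simp
  have lk: "Poly_Mapping.lookup (b + m r) k = Poly_Mapping.lookup b k + (if k = r then 1 else 0)" for k
    by (auto simp: lookup_add m_def lookup_single when_def)
  show "mono_weight (b + m r) = mono_weight b + (r - 1)"
    unfolding mono_over_superset(1)[OF fin sub] mono_over_superset(1)[OF fin subset_insertI] lk
    by (simp add: add_mult_distrib sum.distrib if_distrib[of "\<lambda>x. x * _"] sum.delta[OF fin] cong: if_cong del: sum.insert_if sum.insert)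
  show "mono_size (b + m r) = mono_size b + r"
    unfolding mono_over_superset(2)[OF fin sub] mono_over_superset(2)[OF fin subset_insertI] lk
    by (simp add: add_mult_distrib sum.distrib if_distrib[of "\<lambda>x. x * _"] sum.delta[OF fin] cong: if_cong del: sum.insert_if sum.insert)
  show "mono_eval (b + m r) t = t r * mono_eval b t"
    unfolding mono_over_superset(3)[OF fin sub] mono_over_superset(3)[OF fin subset_insertI] lk
    by (simp add: power_add prod.distrib if_distrib[of "\<lambda>x. _ ^ x"] prod.delta[OF fin] mult.commute cong: if_cong del: prod.insert_if prod.insert)
qed

text \<open>The exponent conditions of the theorem for a partition with norm \<open>A\<close> and support \<open>S\<close>.\<close>

definition bounded_mono :: "nat \<Rightarrow> nat \<Rightarrow> (nat \<Rightarrow>\<^sub>0 nat) \<Rightarrow> bool" where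
  "bounded_mono A S b \<longleftrightarrow> Poly_Mapping.keys b \<subseteq> {2..A + 1} \<and>
     mono_weight b \<le> A \<and> [mono_weight b = A] (mod 2) \<and> mono_size b \<le> S"

text \<open>The functions of \<open>n\<close> and \<open>\<chi>\<close> that are values of an admissible polynomial. The polynomial is given as a
list of terms in which a monomial may occur repeatedly, so that sums and products need no collection of
terms; \<open>mpoly_of_terms\<close> collects them once at the end.\<close>

definition expressible :: "nat \<Rightarrow> nat \<Rightarrow> (nat \<Rightarrow> ((nat \<Rightarrow> nat) \<Rightarrow> complex) \<Rightarrow> complex) \<Rightarrow> bool" where
  "expressible A S f \<longleftrightarrow> (\<exists>L. (\<forall>(c, b)\<in>set L. regular_coeff S c \<and> bounded_mono A S b) \<and>
     (\<forall>n\<ge>S. \<forall>\<chi>\<in>Irr (sym_group n). f n \<chi> =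
       (\<Sum>(c, b)\<leftarrow>L. of_rat (ratfun_eval c (of_nat n)) * mono_eval b (\<lambda>r. char_ratio n \<chi> {#r#}))))"

lemma expressible_cong:
  assumes "expressible A S f" "\<And>n \<chi>. n \<ge> S \<Longrightarrow> \<chi> \<in> Irr (sym_group n) \<Longrightarrow> g n \<chi> = f n \<chi>"
  shows "expressible A S g"
  using assms unfolding expressible_def by simp

lemma expressible_mono:
  assumes f: "expressible A S f" and A: "A \<le> A'" "[A = A'] (mod 2)" and S: "S \<le> S'"
  shows "expressible A' S' f"
proof -
  have "bounded_mono A' S' b" if "bounded_mono A S b" for b
    using that A S by (auto simp: bounded_mono_def cong_def)
  moreover obtain L where "\<forall>(c, b)\<in>set L. regular_coeff S c \<and> bounded_mono A S b"
    "\<forall>n\<ge>S. \<forall>\<chi>\<in>Irr (sym_group n). f n \<chi> = (\<Sum>(c, b)\<leftarrow>L.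
      of_rat (ratfun_eval c (of_nat n)) * mono_eval b (\<lambda>r. char_ratio n \<chi> {#r#}))"
    using f unfolding expressible_def by blast
  ultimately show ?thesis
    using S regular_coeff_mono[OF _ S] unfolding expressible_def
    by (intro exI[of _ L]) (auto dest: order_trans)
qed

lemma expressible_zero: "expressible A S (\<lambda>_ _. 0)"
  unfolding expressible_def by (rule exI[of _ "[]"]) simp

lemma expressible_one: "expressible 0 S (\<lambda>_ _. 1)"
  unfolding expressible_def
  by (rule exI[of _ "[(1, 0)]"]) (simp add: bounded_mono_def mono_weight_def mono_size_def mono_eval_def)

lemma expressible_add:
  assumes "expressible A S f" "expressible A S g"
  shows "expressible A S (\<lambda>n \<chi>. f n \<chi> + g n \<chi>)"
proof -
  obtain L L' where "\<forall>(c, b)\<in>set L. regular_coeff S c \<and> bounded_mono A S b"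
    "\<forall>n\<ge>S. \<forall>\<chi>\<in>Irr (sym_group n). f n \<chi> = (\<Sum>(c, b)\<leftarrow>L.
      of_rat (ratfun_eval c (of_nat n)) * mono_eval b (\<lambda>r. char_ratio n \<chi> {#r#}))"
    "\<forall>(c, b)\<in>set L'. regular_coeff S c \<and> bounded_mono A S b"
    "\<forall>n\<ge>S. \<forall>\<chi>\<in>Irr (sym_group n). g n \<chi> = (\<Sum>(c, b)\<leftarrow>L'.
      of_rat (ratfun_eval c (of_nat n)) * mono_eval b (\<lambda>r. char_ratio n \<chi> {#r#}))"
    using assms unfolding expressible_def by metis
  thus ?thesis unfolding expressible_def by (intro exI[of _ "L @ L'"]) auto
qed

lemma expressible_sum_list:
  assumes "\<And>x. x \<in> set xs \<Longrightarrow> expressible A S (f x)"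
  shows "expressible A S (\<lambda>n \<chi>. \<Sum>x\<leftarrow>xs. f x n \<chi>)"
  using assms by (induction xs) (auto intro: expressible_zero expressible_add)

lemma expressible_scale:
  assumes f: "expressible A S f" and c: "regular_coeff S c"
  shows "expressible A S (\<lambda>n \<chi>. of_rat (ratfun_eval c (of_nat n)) * f n \<chi>)"
proof -
  obtain L where L: "\<forall>(c, b)\<in>set L. regular_coeff S c \<and> bounded_mono A S b"
    "\<forall>n\<ge>S. \<forall>\<chi>\<in>Irr (sym_group n). f n \<chi> = (\<Sum>(c, b)\<leftarrow>L.
      of_rat (ratfun_eval c (of_nat n)) * mono_eval b (\<lambda>r. char_ratio n \<chi> {#r#}))"
    using f unfolding expressible_def by blast
  have "(\<Sum>(c', b)\<leftarrow>map (map_prod ((*) c) id) K.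
        of_rat (ratfun_eval c' (of_nat n)) * mono_eval b t) =
      of_rat (ratfun_eval c (of_nat n)) *
      (\<Sum>(c, b)\<leftarrow>K. of_rat (ratfun_eval c (of_nat n)) * mono_eval b t)"
    if "\<forall>(c, b)\<in>set K. regular_coeff S c" "n \<ge> S" for K n t
    using that(1)
  proof (induction K)
    case (Cons x K)
    obtain c' b where x: "x = (c', b)" by (cases x)
    have "ratfun_eval (c * c') (of_nat n) = ratfun_eval c (of_nat n) * ratfun_eval c' (of_nat n)"
      using Cons.prems that(2) by (intro regular_coeff_mult(2)[OF c]) (auto simp: x)
    thus ?case using Cons by (simp add: x of_rat_mult distrib_left)
  qed simp
  hence "\<forall>n\<ge>S. \<forall>\<chi>\<in>Irr (sym_group n). of_rat (ratfun_eval c (of_nat n)) * f n \<chi> =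
      (\<Sum>(c', b)\<leftarrow>map (map_prod ((*) c) id) L.
        of_rat (ratfun_eval c' (of_nat n)) * mono_eval b (\<lambda>r. char_ratio n \<chi> {#r#}))"
    using L by (simp add: case_prod_beta)
  moreover have "\<forall>(c', b)\<in>set (map (map_prod ((*) c) id) L). regular_coeff S c' \<and> bounded_mono A S b"
    using L(1) regular_coeff_mult(1)[OF c] by fastforce
  ultimately show ?thesis unfolding expressible_def by blast
qed

lemma expressible_times_ratio:
  assumes f: "expressible A S f" and r: "r \<ge> 2"
  shows "expressible (r - 1 + A) (r + S) (\<lambda>n \<chi>. char_ratio n \<chi> {#r#} * f n \<chi>)"
proof -
  obtain L where L: "\<forall>(c, b)\<in>set L. regular_coeff S c \<and> bounded_mono A S b"
    "\<forall>n\<ge>S. \<forall>\<chi>\<in>Irr (sym_group n). f n \<chi> = (\<Sum>(c, b)\<leftarrow>L.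
      of_rat (ratfun_eval c (of_nat n)) * mono_eval b (\<lambda>r. char_ratio n \<chi> {#r#}))"
    using f unfolding expressible_def by blast
  let ?M = "map (map_prod id (\<lambda>b. b + Poly_Mapping.single r 1))"
  have "(\<Sum>(c, b)\<leftarrow>?M K. of_rat (ratfun_eval c x) * mono_eval b t) =
      t r * (\<Sum>(c, b)\<leftarrow>K. of_rat (ratfun_eval c x) * mono_eval b t)" for K x t
    by (induction K) (auto simp: mono_times_var[unfolded One_nat_def] distrib_left)
  hence "\<forall>n\<ge>r + S. \<forall>\<chi>\<in>Irr (sym_group n). char_ratio n \<chi> {#r#} * f n \<chi> = (\<Sum>(c, b)\<leftarrow>?M L.
      of_rat (ratfun_eval c (of_nat n)) * mono_eval b (\<lambda>r. char_ratio n \<chi> {#r#}))"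
    using L by simp
  moreover have "bounded_mono (r - 1 + A) (r + S) (b + Poly_Mapping.single r 1)"
    if "bounded_mono A S b" for b
    unfolding bounded_mono_def mono_times_var
  proof (intro conjI)
    have b: "Poly_Mapping.keys b \<subseteq> {2..A + 1}" "mono_weight b \<le> A" "mono_size b \<le> S"
      "[mono_weight b = A] (mod 2)" using that by (auto simp: bounded_mono_def)
    have "insert r (Poly_Mapping.keys b) \<subseteq> {2..r - 1 + A + 1}" using b(1) r by fastforce
    thus "Poly_Mapping.keys (b + Poly_Mapping.single r 1) \<subseteq> {2..r - 1 + A + 1}"
      using mono_times_var(4) by (rule order_trans[rotated])
    show "[mono_weight b + (r - 1) = r - 1 + A] (mod 2)"
      using cong_add[OF b(4) cong_refl[of "r - 1"]] by (simp only: add.commute)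
    show "mono_weight b + (r - 1) \<le> r - 1 + A" "mono_size b + r \<le> r + S" using b by auto
  qed
  hence "\<forall>(c, b)\<in>set (?M L). regular_coeff (r + S) c \<and> bounded_mono (r - 1 + A) (r + S) b"
    using L(1) regular_coeff_mono[of S _ "r + S"] by fastforce
  ultimately show ?thesis unfolding expressible_def by blast
qed

lemma mpoly_eval_superset:
  assumes "finite B" "Poly_Mapping.keys T \<subseteq> B"
  shows "mpoly_eval T t n =
    (\<Sum>b\<in>B. of_rat (ratfun_eval (Poly_Mapping.lookup T b) (of_nat n)) * mono_eval b t)"
  unfolding mpoly_eval_def mono_eval_def
  using assms by (intro sum.mono_neutral_left) (auto simp: in_keys_iff)

text \<open>Collecting terms may create cancellations; this is harmless because the regular coefficients are closed
under addition and no new monomials appear.\<close>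

lemma mpoly_of_terms:
  assumes "\<forall>(c, b)\<in>set L. regular_coeff S c \<and> bounded_mono A S b"
  shows "\<exists>T :: ratfun_mpoly. (\<forall>b. regular_coeff S (Poly_Mapping.lookup T b)) \<and>
    (\<forall>b\<in>Poly_Mapping.keys T. bounded_mono A S b) \<and>
    (\<forall>n\<ge>S. \<forall>t. mpoly_eval T t n =
      (\<Sum>(c, b)\<leftarrow>L. of_rat (ratfun_eval c (of_nat n)) * mono_eval b t))"
  using assms
proof (induction L)
  case Nil
  show ?case by (rule exI[of _ 0]) (simp add: mpoly_eval_def)
next
  case (Cons x L)
  obtain c b where x: "x = (c, b)" by (cases x)
  have c: "regular_coeff S c" "bounded_mono A S b" using Cons.prems x by auto
  have "\<forall>(c, b)\<in>set L. regular_coeff S c \<and> bounded_mono A S b" using Cons.prems by simp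
  then obtain T :: ratfun_mpoly where T: "\<forall>b. regular_coeff S (Poly_Mapping.lookup T b)"
    "\<forall>b\<in>Poly_Mapping.keys T. bounded_mono A S b"
    "\<forall>n\<ge>S. \<forall>t. mpoly_eval T t n =
      (\<Sum>(c, b)\<leftarrow>L. of_rat (ratfun_eval c (of_nat n)) * mono_eval b t)"
    using Cons.IH by blast
  let ?T = "Poly_Mapping.single b c + T" and ?B = "insert b (Poly_Mapping.keys T)"
  have lk: "Poly_Mapping.lookup ?T b' = (if b' = b then c else 0) + Poly_Mapping.lookup T b'" for b'
    by (auto simp: lookup_add lookup_single when_def)
  have keys: "Poly_Mapping.keys ?T \<subseteq> ?B"
    using Poly_Mapping.keys_add[of "Poly_Mapping.single b c" T] by (auto split: if_splits)
  have "mpoly_eval ?T t n = of_rat (ratfun_eval c (of_nat n)) * mono_eval b t + mpoly_eval T t n"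
    if n: "n \<ge> S" for n t
  proof -
    have "mpoly_eval ?T t n = (\<Sum>b'\<in>?B. of_rat (ratfun_eval (if b' = b then c else 0) (of_nat n)) * mono_eval b' t) +
        (\<Sum>b'\<in>?B. of_rat (ratfun_eval (Poly_Mapping.lookup T b') (of_nat n)) * mono_eval b' t)"
      unfolding sum.distrib[symmetric]
    proof (subst mpoly_eval_superset[OF _ keys], simp, intro sum.cong refl)
      fix b' assume "b' \<in> ?B"
      have "regular_coeff S (if b' = b then c else 0)" using c by simp
      from regular_coeff_add(2)[OF this T(1)[rule_format, of b'] n]
      show "of_rat (ratfun_eval (Poly_Mapping.lookup ?T b') (of_nat n)) * mono_eval b' t =
          of_rat (ratfun_eval (if b' = b then c else 0) (of_nat n)) * mono_eval b' t +
          of_rat (ratfun_eval (Poly_Mapping.lookup T b') (of_nat n)) * mono_eval b' t"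
        unfolding lk by (simp add: of_rat_add distrib_right)
    qed
    also have "(\<Sum>b'\<in>?B. of_rat (ratfun_eval (if b' = b then c else 0) (of_nat n)) * mono_eval b' t) =
        (\<Sum>b'\<in>?B. if b' = b then of_rat (ratfun_eval c (of_nat n)) * mono_eval b' t else 0)"
      by (intro sum.cong) auto
    also have "\<dots> = of_rat (ratfun_eval c (of_nat n)) * mono_eval b t"
      by (subst sum.delta) auto
    finally show ?thesis using mpoly_eval_superset[of ?B T t n, OF _ subset_insertI] by simp
  qed
  thus ?case using c T keys x
    by (intro exI[of _ ?T]) (auto simp: lk intro!: regular_coeff_add(1))
qed

section \<open>Character ratios of symmetric groups\<close>

lemma Irr_sym_groupE:
  assumes "\<chi> \<in> Irr (sym_group n)"
  obtains d R where "irreducible_rep (sym_group n) d R" "\<chi> = character_of (sym_group n) d R"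
proof (rule Irr_cases[OF assms sym_group_is_group])
  show "finite (carrier (sym_group n))"
    by (simp add: sym_group_def finite_permutations)
qed (rule that)

lemma Irr_sym_group_id:
  assumes "\<chi> \<in> Irr (sym_group n)"
  shows "\<exists>d>0. \<chi> id = of_nat d"
  using assms
proof (rule Irr_sym_groupE)
  fix d R assume "irreducible_rep (sym_group n) d R" and \<chi>: "\<chi> = character_of (sym_group n) d R"
  then interpret irreducible_rep "sym_group n" d R by simp
  show ?thesis using d_pos character_one by (auto simp: \<chi> sym_group_one)
qed

lemma Irr_sym_group_conj:
  assumes "\<chi> \<in> Irr (sym_group n)" "g permutes {1..n}" "z permutes {1..n}"
  shows "\<chi> (g \<circ> z \<circ> inv' g) = \<chi> z"
  using assms(1)
proof (rule Irr_sym_groupE)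
  fix d R assume "irreducible_rep (sym_group n) d R" and \<chi>: "\<chi> = character_of (sym_group n) d R"
  then interpret irreducible_rep "sym_group n" d R by simp
  show ?thesis using character_conj[of g z] assms(2,3)
    by (simp add: \<chi> sym_group_carrier sym_group_mult)
qed

lemma Irr_sym_group_conj_sum:
  assumes "\<chi> \<in> Irr (sym_group n)" "x permutes {1..n}" "y permutes {1..n}"
  shows "(\<Sum>g | g permutes {1..n}. \<chi> (g \<circ> x \<circ> inv' g \<circ> y)) =
    of_nat (card {g. g permutes {1..n}}) * \<chi> x * \<chi> y / \<chi> id"
  using assms(1)
proof (rule Irr_sym_groupE)
  fix d R assume "irreducible_rep (sym_group n) d R" and \<chi>: "\<chi> = character_of (sym_group n) d R"
  then interpret irreducible_rep "sym_group n" d R by simp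
  have "(\<Sum>g | g permutes {1..n}. \<chi> (g \<circ> x \<circ> inv' g \<circ> y)) =
      (\<Sum>g\<in>carrier (sym_group n). \<chi> (g \<otimes>\<^bsub>sym_group n\<^esub> x \<otimes>\<^bsub>sym_group n\<^esub> inv\<^bsub>sym_group n\<^esub> g \<otimes>\<^bsub>sym_group n\<^esub> y))"
    by (intro sum.cong) (auto simp: sym_group_mult sym_group_carrier)
  also have "\<dots> = of_nat (card {g. g permutes {1..n}}) * \<chi> x * \<chi> y / \<chi> id"
    using character_conj_sum[of x y] assms(2,3)
    by (simp add: \<chi> sym_group_carrier sym_group_one Coset.order_def sym_group_def)
  finally show ?thesis .
qed

text \<open>The class named by a partition is a single conjugacy class, so the value of \<open>\<chi>\<close> on it may be taken at
any element.\<close>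

lemma char_ratio_eq:
  assumes \<chi>: "\<chi> \<in> Irr (sym_group n)" and z: "z permutes {1..n}"
    and type: "cycle_type n z = \<mu> + replicate_mset (n - sum_mset \<mu>) 1"
  shows "char_ratio n \<chi> \<mu> = \<chi> z / \<chi> id"
proof -
  have "\<chi> w = \<chi> z" if w: "w \<in> cycle_class n \<mu>" for w
  proof -
    have "w permutes {1..n}" "cycle_type n z = cycle_type n w"
      using w type by (auto simp: cycle_class_def sym_group_carrier)
    with conjugate_if_cycle_type_eq[OF z] show ?thesis
      using Irr_sym_group_conj[OF \<chi> _ z] by metis
  qed
  moreover have "z \<in> cycle_class n \<mu>" using z type by (simp add: cycle_class_def sym_group_carrier)
  ultimately have "\<chi> ` cycle_class n \<mu> = {\<chi> z}" by (metis image_cong image_constant)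
  thus ?thesis by (simp add: char_ratio_def class_value_def sym_group_one)
qed

section \<open>Sums over cycles with a given beginning\<close>

definition distinct_lists :: "nat \<Rightarrow> 'a set \<Rightarrow> 'a list set" where
  "distinct_lists j A = {u. length u = j \<and> distinct u \<and> set u \<subseteq> A}"

lemma distinct_lists_0 [simp]: "distinct_lists 0 A = {[]}"
  by (auto simp: distinct_lists_def)

lemma finite_distinct_lists: "finite A \<Longrightarrow> finite (distinct_lists j A)"
  by (rule finite_subset[OF _ finite_lists_length_eq[of A j]]) (auto simp: distinct_lists_def)

lemma sum_distinct_lists_map:
  assumes "bij g"
  shows "(\<Sum>u\<in>distinct_lists j A. F (map g u)) = (\<Sum>u\<in>distinct_lists j (g ` A). F u)"
proof (rule sum.reindex_bij_betw)
  have inj: "inj g" using assms by (rule bij_is_inj)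
  show "bij_betw (map g) (distinct_lists j A) (distinct_lists j (g ` A))"
  proof (rule bij_betw_byWitness[where f' = "map (inv' g)"])
    show "\<forall>u\<in>distinct_lists j A. map (inv' g) (map g u) = u" using inj by simp
    show "\<forall>u\<in>distinct_lists j (g ` A). map g (map (inv' g) u) = u"
      using assms by (simp add: surj_f_inv_f bij_is_surj map_idI)
    show "map g ` distinct_lists j A \<subseteq> distinct_lists j (g ` A)"
      using inj by (auto simp: distinct_lists_def distinct_map inj_on_subset)
        (metis imageI subsetD)
    show "map (inv' g) ` distinct_lists j (g ` A) \<subseteq> distinct_lists j A"
      using inj bij_is_inj[OF bij_imp_bij_inv[OF assms]]
      by (fastforce simp: distinct_lists_def distinct_map inj_on_subset)
  qed
qed

lemma sum_distinct_lists_Suc: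
  assumes "finite A"
  shows "(\<Sum>u\<in>distinct_lists (Suc j) A. F u) =
    (\<Sum>a\<in>A. \<Sum>v\<in>distinct_lists j (A - {a}). F (a # v))"
proof -
  have "(\<Sum>a\<in>A. \<Sum>v\<in>distinct_lists j (A - {a}). F (a # v)) =
      (\<Sum>(a, v)\<in>Sigma A (\<lambda>a. distinct_lists j (A - {a})). F (a # v))"
    using assms by (intro sum.Sigma) (auto intro: finite_distinct_lists)
  also have "\<dots> = (\<Sum>u\<in>distinct_lists (Suc j) A. F u)"
    by (rule sum.reindex_bij_witness[of _ "\<lambda>u. (hd u, tl u)" "\<lambda>(a, v). a # v"])
      (auto simp: distinct_lists_def length_Suc_conv)
  finally show ?thesis by simp
qed

text \<open>Evaluated at \<open>n\<close>, this is the falling factorial \<open>(n - s) (n - s - 1) \<dots> (n - s - j + 1)\<close>.\<close>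

definition falling_poly :: "nat \<Rightarrow> nat \<Rightarrow> rat poly" where
  "falling_poly s j = (\<Prod>i<j. [:- of_nat (s + i), 1:])"

lemma falling_poly_Suc: "falling_poly s (Suc j) = [:- of_nat s, 1:] * falling_poly (Suc s) j"
  unfolding falling_poly_def prod.lessThan_Suc_shift by (simp only: add_Suc_shift add_0_right)

lemma degree_falling_poly: "degree (falling_poly s j) = j"
  unfolding falling_poly_def by (subst degree_prod_sum_eq) auto

lemma falling_poly_nonzero: "n \<ge> s + j \<Longrightarrow> poly (falling_poly s j) (of_nat n) \<noteq> 0"
  by (auto simp: falling_poly_def poly_prod simp flip: of_nat_add)

text \<open>The induction on \<open>j\<close> removes a point from \<open>A\<close>, which is compensated by a shift \<open>s\<close> of the polynomial.\<close>

lemma card_distinct_lists: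
  assumes "finite A"
  shows "of_nat (card (distinct_lists j A)) = poly (falling_poly 0 j) (of_nat (card A))"
proof -
  have "of_nat (card (distinct_lists j A)) = poly (falling_poly s j) (of_nat (s + card A))" for s
    using assms
  proof (induction j arbitrary: A s)
    case 0
    show ?case by (simp add: falling_poly_def)
  next
    case (Suc j)
    have "rat_of_nat (card (distinct_lists (Suc j) A)) =
        (\<Sum>a\<in>A. of_nat (card (distinct_lists j (A - {a}))))"
      using sum_distinct_lists_Suc[OF Suc.prems, of "\<lambda>_. 1 :: rat" j] by simp
    also have "\<dots> = (\<Sum>a\<in>A. poly (falling_poly (Suc s) j) (of_nat (s + card A)))"
    proof (rule sum.cong)
      fix a assume a: "a \<in> A"
      have "card A > 0" using a Suc.prems by (auto simp: card_gt_0_iff)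
      hence "Suc s + card (A - {a}) = s + card A" using a Suc.prems by simp
      thus "of_nat (card (distinct_lists j (A - {a}))) =
          poly (falling_poly (Suc s) j) (of_nat (s + card A))"
        using Suc.IH[of "A - {a}" "Suc s"] Suc.prems by (simp only: finite_Diff)
    qed simp
    also have "\<dots> = poly (falling_poly s (Suc j)) (of_nat (s + card A))"
      by (simp add: falling_poly_Suc distrib_right)
    finally show ?case .
  qed
  from this[of 0] show ?thesis by simp
qed

lemma cycle_type_cycle:
  assumes "distinct u" "u \<noteq> []" "set u \<subseteq> {1..n}"
  shows "cycle_type n (cycle_of_list u) = add_mset (length u) (replicate_mset (n - length u) 1)"
proof -
  define xs where "xs = sorted_list_of_set ({1..n} - set u)"
  have xs: "distinct xs" "set xs = {1..n} - set u" by (simp_all add: xs_def)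
  have "perm_of_cycles (map (\<lambda>x. [x]) xs) = id" by (induction xs) auto
  hence "cycle_decomposition_of (u # map (\<lambda>x. [x]) xs) {1..n} (cycle_of_list u)"
    using assms xs by (auto simp: cycle_decomposition_of_def)
  moreover have "length xs = n - length u"
    using xs assms(1,3) by (simp add: distinct_card[symmetric] card_Diff_subset)
  ultimately show ?thesis by (simp add: cycle_type_eq comp_def image_mset_const_eq)
qed

lemma char_ratio_cycle:
  assumes "\<chi> \<in> Irr (sym_group n)" "u \<in> distinct_lists r {1..n}" "r \<ge> 1"
  shows "char_ratio n \<chi> {#r#} = \<chi> (cycle_of_list u) / \<chi> id"
proof (rule char_ratio_eq[OF assms(1)])
  have u: "distinct u" "u \<noteq> []" "set u \<subseteq> {1..n}" "length u = r"
    using assms(2,3) by (auto simp: distinct_lists_def)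
  show "cycle_of_list u permutes {1..n}" using permutes_subset[OF cycle_permutes u(3)] .
  show "cycle_type n (cycle_of_list u) = {#r#} + replicate_mset (n - sum_mset {#r#}) 1"
    using cycle_type_cycle[OF u(1-3)] u(4) by simp
qed

text \<open>Prescribing the beginning \<open>w\<close> of the cycle makes it possible to choose its points one at a time; \<open>j\<close> is the
number of points that are still free.\<close>

definition cycle_sum :: "nat \<Rightarrow> ((nat \<Rightarrow> nat) \<Rightarrow> complex) \<Rightarrow> nat list \<Rightarrow> nat \<Rightarrow> (nat \<Rightarrow> nat) \<Rightarrow> complex" where
  "cycle_sum n \<chi> w j y =
     (\<Sum>u\<in>distinct_lists j ({1..n} - set w). \<chi> (cycle_of_list (w @ u) \<circ> y) / \<chi> id)"

lemma cycle_sum_conj: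
  assumes \<chi>: "\<chi> \<in> Irr (sym_group n)" and g: "g permutes {1..n}"
    and w: "distinct w" "set w \<subseteq> {1..n}" and y: "y permutes {1..n}"
  shows "cycle_sum n \<chi> (map g w) j (g \<circ> y \<circ> inv' g) = cycle_sum n \<chi> w j y"
proof -
  have bij: "bij g" using g by (rule permutes_bij)
  have img: "{1..n} - set (map g w) = g ` ({1..n} - set w)"
    using bij permutes_image[OF g] by (simp add: image_set_diff bij_is_inj)
  have "\<chi> (cycle_of_list (map g w @ map g u) \<circ> (g \<circ> y \<circ> inv' g)) = \<chi> (cycle_of_list (w @ u) \<circ> y)"
    if u: "u \<in> distinct_lists j ({1..n} - set w)" for u
  proof -
    have wu: "distinct (w @ u)" "set (w @ u) \<subseteq> {1..n}" using u w by (auto simp: distinct_lists_def)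
    have "cycle_of_list (map g w @ map g u) = g \<circ> cycle_of_list (w @ u) \<circ> inv' g"
      using conjugation_of_cycle[OF wu(1) bij] by simp
    hence "cycle_of_list (map g w @ map g u) \<circ> (g \<circ> y \<circ> inv' g) =
        g \<circ> (cycle_of_list (w @ u) \<circ> y) \<circ> inv' g"
      using bij by (simp add: fun_eq_iff bij_is_inj)
    moreover have "cycle_of_list (w @ u) \<circ> y permutes {1..n}"
      using y permutes_subset[OF cycle_permutes wu(2)] by (rule permutes_compose)
    ultimately show ?thesis using Irr_sym_group_conj[OF \<chi> g] by simp
  qed
  thus ?thesis
    unfolding cycle_sum_def img sum_distinct_lists_map[OF bij, symmetric] by (intro sum.cong) auto
qed

lemma cycle_sum_Suc:
  assumes w: "set w \<subseteq> {1..n}"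
  shows "cycle_sum n \<chi> w (Suc j) y = (\<Sum>a\<in>{1..n} - set w. cycle_sum n \<chi> (w @ [a]) j y)"
proof -
  have "{1..n} - set w - {a} = {1..n} - set (w @ [a])" for a by auto
  thus ?thesis unfolding cycle_sum_def by (subst sum_distinct_lists_Suc) simp_all
qed

text \<open>The next point of the cycle is one of the points of \<open>{1..s}\<close> or one of the \<open>n - s\<close> points outside.
Points outside contribute equally, since the transposition of two of them fixes both \<open>w\<close> and \<open>y\<close>.\<close>

lemma cycle_sum_fresh:
  assumes \<chi>: "\<chi> \<in> Irr (sym_group n)" and w: "distinct w" "set w \<subseteq> {1..s}"
    and y: "y permutes {1..s}" and n: "n \<ge> s + Suc j"
  shows "cycle_sum n \<chi> w (Suc j) y = (\<Sum>a\<in>{1..s} - set w. cycle_sum n \<chi> (w @ [a]) j y) +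
    of_nat (n - s) * cycle_sum n \<chi> (w @ [Suc s]) j y"
proof -
  have fresh: "cycle_sum n \<chi> (w @ [a]) j y = cycle_sum n \<chi> (w @ [Suc s]) j y" if a: "a \<in> {s<..n}" for a
  proof -
    let ?t = "transpose a (Suc s)"
    have t: "?t permutes {1..n}" using a n by (intro permutes_swap_id) auto
    have "?t x = x" if "x \<in> {1..s}" for x
      using that a by (auto simp: transpose_def)
    moreover have "y x = x" if "x \<notin> {1..s}" for x using y that by (rule permutes_not_in)
    moreover have "y x \<in> {1..s} \<longleftrightarrow> x \<in> {1..s}" for x using permutes_in_image[OF y] .
    moreover have tt: "?t x \<in> {1..s} \<longleftrightarrow> x \<in> {1..s}" for x
      using a by (auto simp: transpose_def)
    ultimately have "?t (y (?t x)) = y x" for x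
      by (cases "x \<in> {1..s}") (metis, metis transpose_involutory)
    hence "?t \<circ> y \<circ> inv' ?t = y" by (simp add: fun_eq_iff)
    moreover have "map ?t w = w" using w(2) a by (intro map_idI) (auto simp: transpose_def)
    ultimately have "cycle_sum n \<chi> (w @ [Suc s]) j y =
        cycle_sum n \<chi> (map ?t (w @ [a])) j (?t \<circ> y \<circ> inv' ?t)" by simp
    also have "\<dots> = cycle_sum n \<chi> (w @ [a]) j y"
    proof (rule cycle_sum_conj[OF \<chi> t])
      show "distinct (w @ [a])" "set (w @ [a]) \<subseteq> {1..n}" using w a n by auto
      show "y permutes {1..n}" using y by (rule permutes_subset) (use n in auto)
    qed
    finally show ?thesis ..
  qed
  have wn: "set w \<subseteq> {1..n}" using w(2) n by fastforce
  have "{1..n} - set w = ({1..s} - set w) \<union> {s<..n}" using w n by auto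
  hence "cycle_sum n \<chi> w (Suc j) y = (\<Sum>a\<in>({1..s} - set w) \<union> {s<..n}. cycle_sum n \<chi> (w @ [a]) j y)"
    using cycle_sum_Suc[OF wn] by (simp only:)
  also have "\<dots> = (\<Sum>a\<in>{1..s} - set w. cycle_sum n \<chi> (w @ [a]) j y) +
      (\<Sum>a\<in>{s<..n}. cycle_sum n \<chi> (w @ [a]) j y)"
    by (rule sum.union_disjoint) auto
  also have "(\<Sum>a\<in>{s<..n}. cycle_sum n \<chi> (w @ [a]) j y) =
      (\<Sum>a\<in>{s<..n}. cycle_sum n \<chi> (w @ [Suc s]) j y)"
    by (intro sum.cong fresh refl)
  also have "\<dots> = of_nat (n - s) * cycle_sum n \<chi> (w @ [Suc s]) j y" by simp
  finally show ?thesis .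
qed

text \<open>The set of all \<open>r\<close>-cycles is invariant under conjugation, so its sum may be averaged over conjugation
by all \<open>g\<close>, and the averaging identity for characters applies to each summand.\<close>

lemma cycle_sum_product:
  assumes \<chi>: "\<chi> \<in> Irr (sym_group n)" and y: "y permutes {1..n}" and r: "r \<ge> 1"
  shows "cycle_sum n \<chi> [] r y =
    of_rat (poly (falling_poly 0 r) (of_nat n)) * (char_ratio n \<chi> {#r#} * (\<chi> y / \<chi> id))"
proof -
  let ?S = "{g. g permutes {1..n}}" and ?D = "distinct_lists r {1..n}"
  have fin: "finite ?S" by (simp add: finite_permutations)
  have "?S \<noteq> {}" using permutes_id by blast
  hence card: "of_nat (card ?S) \<noteq> (0 :: complex)" using fin by (simp only: of_nat_eq_0_iff card_0_eq not_False_eq_True)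
  have id: "\<chi> id \<noteq> 0" using Irr_sym_group_id[OF \<chi>] by auto
  have "of_nat (card ?S) * (\<Sum>u\<in>?D. \<chi> (cycle_of_list u \<circ> y)) =
      (\<Sum>g\<in>?S. \<Sum>u\<in>?D. \<chi> (cycle_of_list u \<circ> y))" by simp
  also have "\<dots> = (\<Sum>g\<in>?S. \<Sum>u\<in>?D. \<chi> (g \<circ> cycle_of_list u \<circ> inv' g \<circ> y))"
  proof (rule sum.cong[OF refl])
    fix g assume g: "g \<in> ?S"
    hence bij: "bij g" and img: "g ` {1..n} = {1..n}" by (auto simp: permutes_bij permutes_image)
    have "(\<Sum>u\<in>?D. \<chi> (cycle_of_list u \<circ> y)) = (\<Sum>u\<in>?D. \<chi> (cycle_of_list (map g u) \<circ> y))"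
      using sum_distinct_lists_map[OF bij, of "\<lambda>u. \<chi> (cycle_of_list u \<circ> y)" r "{1..n}"] img by simp
    also have "\<dots> = (\<Sum>u\<in>?D. \<chi> (g \<circ> cycle_of_list u \<circ> inv' g \<circ> y))"
      by (intro sum.cong refl) (simp only: conjugation_of_cycle[OF _ bij] distinct_lists_def mem_Collect_eq)
    finally show "(\<Sum>u\<in>?D. \<chi> (cycle_of_list u \<circ> y)) = (\<Sum>u\<in>?D. \<chi> (g \<circ> cycle_of_list u \<circ> inv' g \<circ> y))" .
  qed
  also have "\<dots> = (\<Sum>u\<in>?D. \<Sum>g\<in>?S. \<chi> (g \<circ> cycle_of_list u \<circ> inv' g \<circ> y))" by (rule sum.swap)
  also have "\<dots> = (\<Sum>u\<in>?D. of_nat (card ?S) * (char_ratio n \<chi> {#r#} * \<chi> y))"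
  proof (rule sum.cong[OF refl])
    fix u assume u: "u \<in> ?D"
    hence "cycle_of_list u permutes {1..n}"
      by (intro permutes_subset[OF cycle_permutes]) (simp add: distinct_lists_def)
    from Irr_sym_group_conj_sum[OF \<chi> this y]
    show "(\<Sum>g\<in>?S. \<chi> (g \<circ> cycle_of_list u \<circ> inv' g \<circ> y)) = of_nat (card ?S) * (char_ratio n \<chi> {#r#} * \<chi> y)"
      using char_ratio_cycle[OF \<chi> u r] by simp
  qed
  also have "\<dots> = of_nat (card ?S) * (of_nat (card ?D) * (char_ratio n \<chi> {#r#} * \<chi> y))" by simp
  finally have "(\<Sum>u\<in>?D. \<chi> (cycle_of_list u \<circ> y)) = of_nat (card ?D) * (char_ratio n \<chi> {#r#} * \<chi> y)"
    using card by (simp only: mult_cancel_left) simp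
  moreover have "of_rat (poly (falling_poly 0 r) (of_nat n)) = (of_nat (card ?D) :: complex)"
    using card_distinct_lists[of "{1..n}" r]
    by (metis card_atLeastAtMost diff_Suc_1 finite_atLeastAtMost of_rat_of_nat_eq)
  ultimately show ?thesis by (simp add: cycle_sum_def flip: sum_divide_distrib)
qed

section \<open>Separating the cycles that avoid the support\<close>

text \<open>Functions that for \<open>n \<ge> N\<close> are linear combinations of the ratios \<open>\<chi>(z) / \<chi>(1)\<close> with \<open>z \<in> Z\<close>. The same
finite list of permutations and of polynomial coefficients serves all \<open>n\<close> and \<open>\<chi>\<close>.\<close>

definition perm_comb :: "nat \<Rightarrow> nat \<Rightarrow> (nat \<Rightarrow> nat) set \<Rightarrow>
    (nat \<Rightarrow> ((nat \<Rightarrow> nat) \<Rightarrow> complex) \<Rightarrow> complex) \<Rightarrow> bool" where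
  "perm_comb N j Z f \<longleftrightarrow> (\<exists>L. (\<forall>(p, z)\<in>set L. degree p \<le> j \<and> z \<in> Z) \<and>
     (\<forall>n\<ge>N. \<forall>\<chi>\<in>Irr (sym_group n). f n \<chi> =
       (\<Sum>(p, z)\<leftarrow>L. of_rat (poly p (of_nat n)) * (\<chi> z / \<chi> id))))"

lemma perm_comb_cong:
  assumes "perm_comb N j Z f" "\<And>n \<chi>. n \<ge> N \<Longrightarrow> \<chi> \<in> Irr (sym_group n) \<Longrightarrow> g n \<chi> = f n \<chi>"
  shows "perm_comb N j Z g"
  using assms unfolding perm_comb_def by simp

lemma perm_comb_mono:
  assumes f: "perm_comb N j Z f" and "N \<le> N'" "j \<le> j'" "Z \<subseteq> Z'"
  shows "perm_comb N' j' Z' f"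
proof -
  obtain L where "\<forall>(p, z)\<in>set L. degree p \<le> j \<and> z \<in> Z" and
    f: "\<forall>n\<ge>N. \<forall>\<chi>\<in>Irr (sym_group n). f n \<chi> =
       (\<Sum>(p, z)\<leftarrow>L. of_rat (poly p (of_nat n)) * (\<chi> z / \<chi> id))"
    using f unfolding perm_comb_def by blast
  hence "\<forall>(p, z)\<in>set L. degree p \<le> j' \<and> z \<in> Z'" using assms(3,4) by fastforce
  moreover have "\<forall>n\<ge>N'. \<forall>\<chi>\<in>Irr (sym_group n). f n \<chi> =
       (\<Sum>(p, z)\<leftarrow>L. of_rat (poly p (of_nat n)) * (\<chi> z / \<chi> id))"
    using f assms(2) by (meson order_trans)
  ultimately show ?thesis unfolding perm_comb_def by blast
qed

lemma perm_comb_zero: "perm_comb N j Z (\<lambda>_ _. 0)"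
  unfolding perm_comb_def by (rule exI[of _ "[]"]) simp

lemma perm_comb_term:
  assumes "degree p \<le> j" "z \<in> Z"
  shows "perm_comb N j Z (\<lambda>n \<chi>. of_rat (poly p (of_nat n)) * (\<chi> z / \<chi> id))"
  unfolding perm_comb_def using assms by (intro exI[of _ "[(p, z)]"]) simp

lemma perm_comb_add:
  assumes "perm_comb N j Z f" "perm_comb N j Z g"
  shows "perm_comb N j Z (\<lambda>n \<chi>. f n \<chi> + g n \<chi>)"
proof -
  obtain L L' where
    "\<forall>(p, z)\<in>set L. degree p \<le> j \<and> z \<in> Z" "\<forall>(p, z)\<in>set L'. degree p \<le> j \<and> z \<in> Z"
    "\<forall>n\<ge>N. \<forall>\<chi>\<in>Irr (sym_group n). f n \<chi> =
       (\<Sum>(p, z)\<leftarrow>L. of_rat (poly p (of_nat n)) * (\<chi> z / \<chi> id))"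
    "\<forall>n\<ge>N. \<forall>\<chi>\<in>Irr (sym_group n). g n \<chi> =
       (\<Sum>(p, z)\<leftarrow>L'. of_rat (poly p (of_nat n)) * (\<chi> z / \<chi> id))"
    using assms unfolding perm_comb_def by metis
  thus ?thesis unfolding perm_comb_def by (intro exI[of _ "L @ L'"]) auto
qed

lemma perm_comb_sum:
  assumes "finite A" "\<And>a. a \<in> A \<Longrightarrow> perm_comb N j Z (f a)"
  shows "perm_comb N j Z (\<lambda>n \<chi>. \<Sum>a\<in>A. f a n \<chi>)"
  using assms by (induction A) (auto intro: perm_comb_zero perm_comb_add)

lemma perm_comb_scale:
  assumes f: "perm_comb N j Z f"
  shows "perm_comb N (degree q + j) Z (\<lambda>n \<chi>. of_rat (poly q (of_nat n)) * f n \<chi>)"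
proof -
  obtain L where L: "\<forall>(p, z)\<in>set L. degree p \<le> j \<and> z \<in> Z" and
    f: "\<forall>n\<ge>N. \<forall>\<chi>\<in>Irr (sym_group n). f n \<chi> =
       (\<Sum>(p, z)\<leftarrow>L. of_rat (poly p (of_nat n)) * (\<chi> z / \<chi> id))"
    using f unfolding perm_comb_def by blast
  let ?M = "map (map_prod ((*) q) id)"
  have "(\<Sum>(p, z)\<leftarrow>?M K. of_rat (poly p x) * (\<chi> z / \<chi> id)) =
      of_rat (poly q x) * (\<Sum>(p, z)\<leftarrow>K. of_rat (poly p x) * (\<chi> z / \<chi> id))"
    for K x and \<chi> :: "(nat \<Rightarrow> nat) \<Rightarrow> complex"
    by (induction K) (auto simp: of_rat_mult distrib_left)
  hence "\<forall>n\<ge>N. \<forall>\<chi>\<in>Irr (sym_group n). of_rat (poly q (of_nat n)) * f n \<chi> =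
       (\<Sum>(p, z)\<leftarrow>?M L. of_rat (poly p (of_nat n)) * (\<chi> z / \<chi> id))"
    using f by (simp del: map_map)
  moreover have "\<forall>(p, z)\<in>set (?M L). degree p \<le> degree q + j \<and> z \<in> Z"
    using L by (fastforce intro: order_trans[OF degree_mult_le])
  ultimately show ?thesis unfolding perm_comb_def by blast
qed

definition cycle_products :: "(nat \<Rightarrow> nat) \<Rightarrow> nat \<Rightarrow> nat \<Rightarrow> (nat \<Rightarrow> nat) set" where
  "cycle_products y l m = (\<lambda>v. cycle_of_list v \<circ> y) ` distinct_lists l {1..m}"

lemma cycle_products_mono: "m \<le> m' \<Longrightarrow> cycle_products y l m \<subseteq> cycle_products y l m'"
  unfolding cycle_products_def distinct_lists_def by (intro image_mono) fastforce

text \<open>The \<open>j\<close> remaining points of the cycle are chosen one at a time. A choice inside \<open>{1..s}\<close> leaves one point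
fewer to place outside, so that all later terms live on \<open>{1..s + j - 1}\<close>. A choice outside may be taken
to be \<open>s + 1\<close>; it contributes a factor \<open>n - s\<close> and enlarges \<open>s\<close> by one. Only the branch in which all
choices are outside produces a cycle that reaches the point \<open>s + j\<close>, and its factors multiply to the
falling factorial.\<close>

lemma cycle_sum_expansion:
  assumes "distinct w" "set w \<subseteq> {1..s}" "y permutes {1..s}"
  shows "perm_comb (s + j) j
(cycle_products y (length w + j) (s + j - 1))
    (\<lambda>n \<chi>. cycle_sum n \<chi> w j y - of_rat (poly (falling_poly s j) (of_nat n)) *
       (\<chi> (cycle_of_list (w @ [s + 1..<s + j + 1]) \<circ> y) / \<chi> id))"
  using assms
proof (induction j arbitrary: w s)
  case 0
  show ?case by (rule perm_comb_cong[OF perm_comb_zero]) (simp add: cycle_sum_def falling_poly_def o_def id_def)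
next
  case (Suc j)
  define Z where "Z = cycle_products y (length w + Suc j) (s + Suc j - 1)"
  have sub: "cycle_products y (length (w @ [a]) + j) m \<subseteq> Z" if "m \<le> s + j" for a m
    using cycle_products_mono[OF that, of y] by (simp add: Z_def)
  define top where "top = (\<lambda>w s j (n::nat) \<chi>. of_rat (poly (falling_poly s j) (of_nat n)) *
    (\<chi> (cycle_of_list (w @ [s + 1..<s + j + 1]) \<circ> y) / \<chi> id :: complex))"
  have old: "perm_comb (s + Suc j) (Suc j) Z (\<lambda>n \<chi>. cycle_sum n \<chi> (w @ [a]) j y)"
    if a: "a \<in> {1..s} - set w" for a
  proof -
    have "perm_comb (s + Suc j) (Suc j) Z (\<lambda>n \<chi>. cycle_sum n \<chi> (w @ [a]) j y - top (w @ [a]) s j n \<chi>)"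
      unfolding top_def
    proof (rule perm_comb_mono[OF Suc.IH])
      show "distinct (w @ [a])" "set (w @ [a]) \<subseteq> {1..s}" using Suc.prems a by auto
      show "cycle_products y (length (w @ [a]) + j) (s + j - 1) \<subseteq> Z" by (rule sub) simp
    qed (use Suc.prems in simp_all)
    moreover have "perm_comb (s + Suc j) (Suc j) Z (top (w @ [a]) s j)"
      unfolding top_def
    proof (rule perm_comb_term)
      show "cycle_of_list ((w @ [a]) @ [s + 1..<s + j + 1]) \<circ> y \<in> Z"
        unfolding Z_def cycle_products_def
      proof (rule imageI)
        show "(w @ [a]) @ [s + 1..<s + j + 1] \<in> distinct_lists (length w + Suc j) {1..s + Suc j - 1}"
          using Suc.prems a by (auto simp: distinct_lists_def)
      qed
    qed (simp add: degree_falling_poly)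
    ultimately have "perm_comb (s + Suc j) (Suc j) Z
        (\<lambda>n \<chi>. (cycle_sum n \<chi> (w @ [a]) j y - top (w @ [a]) s j n \<chi>) + top (w @ [a]) s j n \<chi>)"
      by (rule perm_comb_add)
    thus ?thesis by simp
  qed
  have "perm_comb (s + Suc j) (degree [:- of_nat s, 1 :: rat:] + j) Z
      (\<lambda>n \<chi>. of_rat (poly [:- of_nat s, 1:] (of_nat n)) *
        (cycle_sum n \<chi> (w @ [Suc s]) j y - top (w @ [Suc s]) (Suc s) j n \<chi>))"
    unfolding top_def
  proof (rule perm_comb_scale, rule perm_comb_mono[OF Suc.IH])
    show "distinct (w @ [Suc s])" "set (w @ [Suc s]) \<subseteq> {1..Suc s}" using Suc.prems by auto
    show "y permutes {1..Suc s}" using Suc.prems(3) by (rule permutes_subset) auto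
    show "cycle_products y (length (w @ [Suc s]) + j) (Suc s + j - 1) \<subseteq> Z" by (rule sub) simp
  qed simp_all
  hence new: "perm_comb (s + Suc j) (Suc j) Z
      (\<lambda>n \<chi>. of_rat (poly [:- of_nat s, 1:] (of_nat n)) *
        (cycle_sum n \<chi> (w @ [Suc s]) j y - top (w @ [Suc s]) (Suc s) j n \<chi>))"
    by simp
  have "perm_comb (s + Suc j) (Suc j) Z (\<lambda>n \<chi>. cycle_sum n \<chi> w (Suc j) y - top w s (Suc j) n \<chi>)"
  proof (rule perm_comb_cong[OF perm_comb_add[OF perm_comb_sum[OF _ old] new]])
    fix n \<chi> assume n: "n \<ge> s + Suc j" and \<chi>: "\<chi> \<in> Irr (sym_group n)"
    have fresh: "w @ [s + 1..<s + Suc j + 1] = (w @ [Suc s]) @ [Suc s + 1..<Suc s + j + 1]"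
      by (simp add: upt_conv_Cons del: upt_Suc)
    have "top w s (Suc j) n \<chi> = of_rat (poly [:- of_nat s, 1:] (of_nat n)) * top (w @ [Suc s]) (Suc s) j n \<chi>"
      unfolding top_def fresh falling_poly_Suc poly_mult of_rat_mult by (simp only: mult.assoc)
    moreover have "of_rat (poly [:- of_nat s, 1:] (of_nat n)) = (of_nat (n - s) :: complex)"
      using n by (simp add: of_nat_diff of_rat_diff)
    ultimately show "cycle_sum n \<chi> w (Suc j) y - top w s (Suc j) n \<chi> =
        (\<Sum>a\<in>{1..s} - set w. cycle_sum n \<chi> (w @ [a]) j y) +
        of_rat (poly [:- of_nat s, 1:] (of_nat n)) *
          (cycle_sum n \<chi> (w @ [Suc s]) j y - top (w @ [Suc s]) (Suc s) j n \<chi>)"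
      unfolding cycle_sum_fresh[OF \<chi> Suc.prems n] by (simp only: right_diff_distrib add_diff_eq)
  qed simp
  thus ?case unfolding Z_def top_def .
qed

lemma expressible_perm_comb_divide:
  assumes f: "perm_comb N j Z f"
    and q: "degree q \<ge> j" "\<And>n. n \<ge> N \<Longrightarrow> poly q (of_nat n) \<noteq> 0"
    and Z: "\<And>z. z \<in> Z \<Longrightarrow> expressible A N (\<lambda>n \<chi>. \<chi> z / \<chi> id)"
  shows "expressible A N (\<lambda>n \<chi>. f n \<chi> / of_rat (poly q (of_nat n)))"
proof -
  obtain L where L: "\<forall>(p, z)\<in>set L. degree p \<le> j \<and> z \<in> Z" and
    f: "\<forall>n\<ge>N. \<forall>\<chi>\<in>Irr (sym_group n). f n \<chi> =
       (\<Sum>(p, z)\<leftarrow>L. of_rat (poly p (of_nat n)) * (\<chi> z / \<chi> id))"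
    using f unfolding perm_comb_def by blast
  let ?c = "\<lambda>p. to_fract p / to_fract q"
  have "expressible A N (\<lambda>n \<chi>. \<Sum>x\<leftarrow>L. of_rat (ratfun_eval (?c (fst x)) (of_nat n)) * (\<chi> (snd x) / \<chi> id))"
  proof (rule expressible_sum_list)
    fix x assume x: "x \<in> set L"
    show "expressible A N (\<lambda>n \<chi>. of_rat (ratfun_eval (?c (fst x)) (of_nat n)) * (\<chi> (snd x) / \<chi> id))"
    proof (rule expressible_scale)
      show "expressible A N (\<lambda>n \<chi>. \<chi> (snd x) / \<chi> id)" using x L by (intro Z) auto
      show "regular_coeff N (?c (fst x))"
        using x L q by (intro regular_coeffI[of N q "fst x"]) auto
    qed
  qed
  thus ?thesis
  proof (rule expressible_cong)
    fix n \<chi> assume n: "n \<ge> N" and \<chi>: "\<chi> \<in> Irr (sym_group n)"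
    have c: "of_rat (ratfun_eval (?c p) (of_nat n)) = (of_rat (poly p (of_nat n)) / of_rat (poly q (of_nat n)) :: complex)" for p
      using ratfun_eval_fract[OF refl q(2)[OF n]] by (simp add: of_rat_divide)
    have "(\<Sum>(p, z)\<leftarrow>K. of_rat (poly p (of_nat n)) * (\<chi> z / \<chi> id)) / of_rat (poly q (of_nat n)) =
        (\<Sum>x\<leftarrow>K. of_rat (ratfun_eval (?c (fst x)) (of_nat n)) * (\<chi> (snd x) / \<chi> id))" for K
      unfolding c by (induction K) (auto simp: add_divide_distrib)
    thus "f n \<chi> / of_rat (poly q (of_nat n)) =
        (\<Sum>x\<leftarrow>L. of_rat (ratfun_eval (?c (fst x)) (of_nat n)) * (\<chi> (snd x) / \<chi> id))"
      using f n \<chi> by simp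
  qed
qed

section \<open>The recursion on the support\<close>

lemma part_norm_filter [simp]: "part_norm (filter_mset (\<lambda>k. k \<ge> 2) \<mu>) = part_norm \<mu>"
  by (simp add: part_norm_def filter_filter_mset)

lemma part_supp_eq_sum: "part_supp \<mu> = sum_mset (filter_mset (\<lambda>k. k \<ge> 2) \<mu>)"
  by (simp add: part_supp_def)

lemma sum_mset_filter_le: "sum_mset (filter_mset P \<mu>) \<le> sum_mset (\<mu> :: nat multiset)"
  by (induction \<mu>) auto

text \<open>Parts equal to 1 can be dropped from a partition without changing the class of \<open>S\<^sub>n\<close> that it names.\<close>

lemma add_ones_filter:
  assumes "\<forall>k\<in>#\<mu>. k \<ge> 1" "sum_mset \<mu> \<le> n"
  defines "\<nu> \<equiv> filter_mset (\<lambda>k. k \<ge> 2) \<mu>"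
  shows "\<mu> + replicate_mset (n - sum_mset \<mu>) 1 = \<nu> + replicate_mset (n - sum_mset \<nu>) 1"
proof -
  have "filter_mset (\<lambda>k. \<not> k \<ge> 2) \<mu> = filter_mset (\<lambda>k. k = 1) \<mu>"
    using assms(1) by (intro filter_mset_cong refl) force
  also have "\<dots> = replicate_mset (count \<mu> 1) 1" by (rule filter_eq_replicate_mset)
  finally have \<mu>: "\<mu> = \<nu> + replicate_mset (count \<mu> 1) 1"
    using multiset_partition[of \<mu> "\<lambda>k. k \<ge> 2"] by (simp add: \<nu>_def)
  have sum: "sum_mset \<mu> = sum_mset \<nu> + count \<mu> 1" by (subst \<mu>) simp
  have "replicate_mset (count \<mu> 1) 1 + replicate_mset (n - sum_mset \<mu>) 1 =
      replicate_mset (n - sum_mset \<nu>) (1::nat)"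
    using sum assms(2) by (intro multiset_eqI) auto
  thus "\<mu> + replicate_mset (n - sum_mset \<mu>) 1 = \<nu> + replicate_mset (n - sum_mset \<nu>) 1"
    by (subst (1) \<mu>) (simp only: add.assoc)
qed

lemma char_ratio_filter:
  assumes "\<forall>k\<in>#\<mu>. k \<ge> 1" "sum_mset \<mu> \<le> n"
  shows "char_ratio n \<chi> \<mu> = char_ratio n \<chi> (filter_mset (\<lambda>k. k \<ge> 2) \<mu>)"
  unfolding char_ratio_def class_value_def cycle_class_def add_ones_filter[OF assms] ..

lemma perm_ratio_eq_char_ratio:
  assumes \<chi>: "\<chi> \<in> Irr (sym_group n)" and z: "z permutes {1..m}" and n: "m \<le> n"
  shows "\<chi> z / \<chi> id = char_ratio n \<chi> (filter_mset (\<lambda>k. k \<ge> 2) (cycle_type m z))"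
proof -
  have part: "\<forall>k\<in>#cycle_type m z. k \<ge> 1" "sum_mset (cycle_type m z) = m"
    using cycle_type_is_partition[OF z] by (auto simp: is_partition_of_def)
  have "z permutes {1..n}" using z by (rule permutes_subset) (use n in auto)
  moreover have "cycle_type n z = cycle_type m z + replicate_mset (n - sum_mset (cycle_type m z)) 1"
    using cycle_type_extend[OF z n] part(2) by simp
  ultimately have "char_ratio n \<chi> (cycle_type m z) = \<chi> z / \<chi> id" by (rule char_ratio_eq[OF \<chi>])
  thus ?thesis using char_ratio_filter[OF part(1), where n = n and \<chi> = \<chi>] part(2) n by simp
qed

text \<open>The recursion described at the beginning. It stops at the empty partition; a single part \<open>r\<close> is the case
in which \<open>y\<close> is the identity and \<open>s = 0\<close>.\<close>

lemma expressible_char_ratio: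
  assumes "\<forall>k\<in>#\<mu>. k \<ge> 2"
  shows "expressible (part_norm \<mu>) (sum_mset \<mu>) (\<lambda>n \<chi>. char_ratio n \<chi> \<mu>)"
  using assms
proof (induction "sum_mset \<mu>" arbitrary: \<mu> rule: less_induct)
  case less
  show ?case
  proof (cases \<mu>)
    case empty
    have "char_ratio n \<chi> {#} = 1" if "\<chi> \<in> Irr (sym_group n)" for n \<chi>
    proof -
      have "\<chi> id \<noteq> 0" using Irr_sym_group_id[OF that] by auto
      moreover have "cycle_type 0 id = {#}" by (simp add: cycle_type_def)
      ultimately show ?thesis using perm_ratio_eq_char_ratio[OF that permutes_id, of 0] by simp
    qed
    thus ?thesis using expressible_cong[OF expressible_one] by (simp add: empty part_norm_def)
  next
    case (add r \<beta>)
    have r: "r \<ge> 2" and \<beta>: "\<forall>k\<in>#\<beta>. k \<ge> 2" using less.prems add by auto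
    define s where "s = sum_mset \<beta>"
    have sum: "sum_mset \<mu> = s + r" by (simp add: add s_def)
    have norm: "part_norm \<mu> = r - 1 + part_norm \<beta>" using r by (simp add: add part_norm_def)
    have "is_partition_of \<beta> s" using \<beta> by (force simp: is_partition_of_def s_def)
    then obtain y where y: "y permutes {1..s}" "cycle_type s y = \<beta>" using cycle_type_surj by blast
    have filter_\<beta>: "filter_mset (\<lambda>k. k \<ge> 2) \<beta> = \<beta>"
      using \<beta> by (simp add: filter_mset_eq_conv)
    have filter_\<mu>: "filter_mset (\<lambda>k. k \<ge> 2) \<mu> = \<mu>"
      using less.prems by (simp add: filter_mset_eq_conv)
    define top where "top = cycle_of_list [s + 1..<s + r + 1] \<circ> y"
    have top: "top permutes {1..s + r}" "cycle_type (s + r) top = \<mu>"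
    proof -
      have "y permutes {1..s + r}" using y(1) by (rule permutes_subset) auto
      moreover have "cycle_of_list [s + 1..<s + r + 1] permutes {1..s + r}"
        by (rule permutes_subset[OF cycle_permutes]) auto
      ultimately show "top permutes {1..s + r}" unfolding top_def by (rule permutes_compose)
      show "cycle_type (s + r) top = \<mu>"
        using cycle_type_extend_cycle[OF y(1), of r] r by (simp add: top_def y(2) add)
    qed
    \<comment> \<open>The contribution of the cycles that meet \<open>{1..s}\<close>.\<close>
    define low where "low n \<chi> = cycle_sum n \<chi> [] r y -
      of_rat (poly (falling_poly s r) (of_nat n)) * (\<chi> top / \<chi> id :: complex)" for n \<chi>
    have nz: "poly (falling_poly s r) (of_nat n) \<noteq> 0" if "n \<ge> s + r" for n
      using falling_poly_nonzero that .
    have "perm_comb (s + r) r (cycle_products y r (s + r - 1)) low"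
      using cycle_sum_expansion[of "[]" s y r] y(1) unfolding low_def top_def by simp
    moreover have "expressible (part_norm \<mu>) (s + r) (\<lambda>n \<chi>. \<chi> z / \<chi> id)"
      if z: "z \<in> cycle_products y r (s + r - 1)" for z
    proof -
      let ?m = "s + r - 1"
      obtain v where v: "z = cycle_of_list v \<circ> y" "distinct v" "length v = r" "set v \<subseteq> {1..?m}"
        using z by (auto simp: cycle_products_def distinct_lists_def)
      have ym: "y permutes {1..?m}" using y(1) by (rule permutes_subset) (use r in auto)
      have zm: "z permutes {1..?m}"
        unfolding v(1) using ym permutes_subset[OF cycle_permutes v(4)] by (rule permutes_compose)
      \<comment> \<open>\<open>z\<close> moves at most \<open>s + r - 1\<close> points, so its type is covered by the induction hypothesis.\<close>
      define \<nu> where "\<nu> = filter_mset (\<lambda>k. k \<ge> 2) (cycle_type ?m z)"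
      have "part_norm (cycle_type ?m y) = part_norm \<beta>"
        using cycle_type_extend[OF y(1), of ?m] r by (simp add: y(2) part_norm_def)
      moreover have "v \<noteq> []" using v(3) r by auto
      ultimately have normz: "part_norm (cycle_type ?m z) \<le> part_norm \<mu>"
        "[part_norm (cycle_type ?m z) = part_norm \<mu>] (mod 2)"
        using part_norm_cycle_compose[OF ym v(2) _ v(4)] by (simp_all add: v(1,3) norm)
      have part: "\<forall>k\<in>#cycle_type ?m z. k \<ge> 1" "sum_mset (cycle_type ?m z) = ?m"
        using cycle_type_is_partition[OF zm] by (auto simp: is_partition_of_def)
      have "sum_mset \<nu> \<le> ?m" using sum_mset_filter_le[of "\<lambda>k. k \<ge> 2" "cycle_type ?m z"] part(2) by (simp only: \<nu>_def)
      hence "sum_mset \<nu> < sum_mset \<mu>" using r sum by simp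
      hence "expressible (part_norm \<nu>) (sum_mset \<nu>) (\<lambda>n \<chi>. char_ratio n \<chi> \<nu>)"
        by (rule less.hyps) (simp add: \<nu>_def)
      hence "expressible (part_norm \<mu>) (s + r) (\<lambda>n \<chi>. char_ratio n \<chi> \<nu>)"
        using normz \<open>sum_mset \<nu> < sum_mset \<mu>\<close> sum by (rule_tac expressible_mono) (auto simp: \<nu>_def)
      thus ?thesis
        by (rule expressible_cong) (simp add: perm_ratio_eq_char_ratio[OF _ zm] \<nu>_def)
    qed
    ultimately have low: "expressible (part_norm \<mu>) (s + r)
        (\<lambda>n \<chi>. low n \<chi> / of_rat (poly (falling_poly s r) (of_nat n)))"
      using nz by (intro expressible_perm_comb_divide) (auto simp: degree_falling_poly)
    \<comment> \<open>The number of all lists of \<open>r\<close> points over the number of those that avoid \<open>{1..s}\<close>.\<close>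
    define c where "c = to_fract (falling_poly 0 r) / to_fract (falling_poly s r)"
    have c: "regular_coeff (s + r) c"
      unfolding c_def using nz by (rule regular_coeffI) (auto simp: degree_falling_poly)
    have "regular_coeff (s + r) (- 1)"
      by (rule regular_coeffI[of _ 1 "- 1"]) auto
    note minus = expressible_scale[OF low this]
    have "expressible (part_norm \<beta>) s (\<lambda>n \<chi>. char_ratio n \<chi> \<beta>)"
      unfolding s_def by (rule less.hyps) (use \<beta> r sum s_def in auto)
    from expressible_times_ratio[OF this r]
    have "expressible (part_norm \<mu>) (s + r) (\<lambda>n \<chi>. char_ratio n \<chi> {#r#} * char_ratio n \<chi> \<beta>)"
      by (simp add: norm add.commute)
    note expressible_add[OF expressible_scale[OF this c] minus]
    thus ?thesis unfolding sum
    proof (rule expressible_cong)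
      fix n \<chi> assume n: "n \<ge> s + r" and \<chi>: "\<chi> \<in> Irr (sym_group n)"
      have yn: "y permutes {1..n}" using y(1) by (rule permutes_subset) (use n in auto)
      let ?P = "of_rat (poly (falling_poly 0 r) (of_nat n)) :: complex"
      let ?Q = "of_rat (poly (falling_poly s r) (of_nat n)) :: complex"
      have Q: "?Q \<noteq> 0" using nz[OF n] by simp
      have solve: "m = P / Q * x + - 1 * (l / Q)" if "Q \<noteq> 0" "P * x = Q * m + l" for P Q x m l :: complex
        using that by (simp add: nonzero_eq_divide_eq add_divide_distrib[symmetric] diff_divide_distrib[symmetric])
      have "char_ratio n \<chi> \<beta> = \<chi> y / \<chi> id"
        using perm_ratio_eq_char_ratio[OF \<chi> y(1)] n by (simp add: y(2) filter_\<beta>)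
      moreover have "char_ratio n \<chi> \<mu> = \<chi> top / \<chi> id"
        using perm_ratio_eq_char_ratio[OF \<chi> top(1) n] by (simp add: top(2) filter_\<mu>)
      ultimately have "?P * (char_ratio n \<chi> {#r#} * char_ratio n \<chi> \<beta>) = ?Q * char_ratio n \<chi> \<mu> + low n \<chi>"
        using cycle_sum_product[OF \<chi> yn, of r] r by (simp add: low_def)
      hence "char_ratio n \<chi> \<mu> =
          ?P / ?Q * (char_ratio n \<chi> {#r#} * char_ratio n \<chi> \<beta>) + - 1 * (low n \<chi> / ?Q)"
        by (rule solve[OF Q])
      moreover have "of_rat (ratfun_eval c (of_nat n)) = ?P / ?Q"
        using ratfun_eval_fract[OF c_def nz[OF n]] by (simp add: of_rat_divide)
      moreover have "ratfun_eval (- 1) (of_nat n) = - 1"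
        using ratfun_eval_fract[of "- 1" "- 1" 1 "of_nat n"] by simp
      ultimately show "char_ratio n \<chi> \<mu> =
          of_rat (ratfun_eval c (of_nat n)) * (char_ratio n \<chi> {#r#} * char_ratio n \<chi> \<beta>) +
          of_rat (ratfun_eval (- 1) (of_nat n)) * (low n \<chi> / ?Q)"
        by (simp only: of_rat_minus of_rat_1)
    qed
  qed
qed

lemma char_ratio_polynomial:
  assumes "is_partition_of \<mu> m"
  shows "\<exists>T :: ratfun_mpoly. (\<forall>b. regular_coeff m (Poly_Mapping.lookup T b)) \<and>
    (\<forall>b\<in>Poly_Mapping.keys T. bounded_mono (part_norm \<mu>) (part_supp \<mu>) b) \<and>
    (\<forall>n\<ge>m. \<forall>\<chi>\<in>Irr (sym_group n).
       char_ratio n \<chi> \<mu> = mpoly_eval T (\<lambda>r. char_ratio n \<chi> {#r#}) n)"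
proof -
  define \<nu> where "\<nu> = filter_mset (\<lambda>k. k \<ge> 2) \<mu>"
  have \<mu>: "\<forall>k\<in>#\<mu>. k \<ge> 1" "sum_mset \<mu> = m" using assms by (auto simp: is_partition_of_def)
  have "expressible (part_norm \<nu>) (sum_mset \<nu>) (\<lambda>n \<chi>. char_ratio n \<chi> \<nu>)"
    by (rule expressible_char_ratio) (simp add: \<nu>_def)
  then obtain L where L: "\<forall>(c, b)\<in>set L. regular_coeff (part_supp \<mu>) c \<and>
      bounded_mono (part_norm \<mu>) (part_supp \<mu>) b"
    "\<forall>n\<ge>part_supp \<mu>. \<forall>\<chi>\<in>Irr (sym_group n). char_ratio n \<chi> \<nu> = (\<Sum>(c, b)\<leftarrow>L.
      of_rat (ratfun_eval c (of_nat n)) * mono_eval b (\<lambda>r. char_ratio n \<chi> {#r#}))"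
    unfolding expressible_def \<nu>_def part_supp_eq_sum[symmetric] part_norm_filter by blast
  obtain T :: ratfun_mpoly where T: "\<forall>b. regular_coeff (part_supp \<mu>) (Poly_Mapping.lookup T b)"
    "\<forall>b\<in>Poly_Mapping.keys T. bounded_mono (part_norm \<mu>) (part_supp \<mu>) b"
    "\<forall>n\<ge>part_supp \<mu>. \<forall>t. mpoly_eval T t n =
      (\<Sum>(c, b)\<leftarrow>L. of_rat (ratfun_eval c (of_nat n)) * mono_eval b t)"
    using mpoly_of_terms[OF L(1)] by blast
  have supp: "part_supp \<mu> \<le> m"
    unfolding part_supp_eq_sum \<mu>(2)[symmetric] by (rule sum_mset_filter_le)
  have "char_ratio n \<chi> \<mu> = mpoly_eval T (\<lambda>r. char_ratio n \<chi> {#r#}) n"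
    if "n \<ge> m" "\<chi> \<in> Irr (sym_group n)" for n \<chi>
    using that L(2) T(3) supp char_ratio_filter[OF \<mu>(1), where n = n and \<chi> = \<chi>] \<mu>(2) by (simp add: \<nu>_def)
  thus ?thesis using T(1,2) regular_coeff_mono[OF _ supp] by blast
qed

section \<open>Characters are determined by their ratios on cycles\<close>

text \<open>The polynomial of a class of \<open>S\<^sub>n\<close> involves only cycles of length at most \<open>n\<close>, so the two characters have
the same ratios and are proportional. Their norms agree, and the factor is a quotient of positive
degrees, hence 1.\<close>

lemma Irr_sym_group_determined:
  assumes n: "n \<ge> 1" and \<chi>: "\<chi> \<in> Irr (sym_group n)" and \<psi>: "\<psi> \<in> Irr (sym_group n)"
    and eq: "\<And>r. 2 \<le> r \<Longrightarrow> r \<le> n \<Longrightarrow> char_ratio n \<chi> {#r#} = char_ratio n \<psi> {#r#}"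
  shows "\<chi> = \<psi>"
proof -
  obtain a where a: "a > 0" "\<chi> id = of_nat a" using Irr_sym_group_id[OF \<chi>] by auto
  obtain b where b: "b > 0" "\<psi> id = of_nat b" using Irr_sym_group_id[OF \<psi>] by auto
  have ratio: "\<chi> z / \<chi> id = \<psi> z / \<psi> id" if z: "z permutes {1..n}" for z
  proof -
    let ?\<mu> = "cycle_type n z"
    have part: "is_partition_of ?\<mu> n" by (rule cycle_type_is_partition[OF z])
    have "?\<mu> \<noteq> {#}" using part n by (auto simp: is_partition_of_def)
    hence norm: "part_norm ?\<mu> + 1 \<le> n"
      using part_norm_cycle_type[OF z] by (cases ?\<mu>) auto
    obtain T :: ratfun_mpoly where T: "\<forall>b\<in>Poly_Mapping.keys T. bounded_mono (part_norm ?\<mu>) (part_supp ?\<mu>) b"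
      "\<forall>n'\<ge>n. \<forall>\<chi>\<in>Irr (sym_group n'). char_ratio n' \<chi> ?\<mu> = mpoly_eval T (\<lambda>r. char_ratio n' \<chi> {#r#}) n'"
      using char_ratio_polynomial[OF part] by blast
    have "char_ratio n \<chi> {#r#} = char_ratio n \<psi> {#r#}"
      if "b \<in> Poly_Mapping.keys T" "r \<in> Poly_Mapping.keys b" for b r
    proof -
      have "r \<in> {2..part_norm ?\<mu> + 1}" using T(1) that unfolding bounded_mono_def by blast
      thus ?thesis using norm by (intro eq) auto
    qed
    hence "mpoly_eval T (\<lambda>r. char_ratio n \<chi> {#r#}) n = mpoly_eval T (\<lambda>r. char_ratio n \<psi> {#r#}) n"
      unfolding mpoly_eval_def by simp
    hence "char_ratio n \<chi> ?\<mu> = char_ratio n \<psi> ?\<mu>" using T(2) \<chi> \<psi> by simp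
    moreover have "cycle_type n z = ?\<mu> + replicate_mset (n - sum_mset ?\<mu>) 1"
      using part by (simp add: is_partition_of_def)
    ultimately show ?thesis using char_ratio_eq[OF \<chi> z] char_ratio_eq[OF \<psi> z] by metis
  qed
  have norm: "(\<Sum>z | z permutes {1..n}. \<xi> z * \<xi> (inv' z)) = of_nat (card {z. z permutes {1..n}})"
    and ext: "\<And>z. \<not> z permutes {1..n} \<Longrightarrow> \<xi> z = undefined"
    if \<xi>: "\<xi> \<in> Irr (sym_group n)" for \<xi>
  proof -
    obtain d R where rep: "irreducible_rep (sym_group n) d R" and \<xi>': "\<xi> = character_of (sym_group n) d R"
      using Irr_sym_groupE[OF \<xi>] .
    interpret irreducible_rep "sym_group n" d R by (rule rep)
    have "(\<Sum>z | z permutes {1..n}. \<xi> z * \<xi> (inv' z)) =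
        (\<Sum>z\<in>carrier (sym_group n). \<xi> z * \<xi> (inv\<^bsub>sym_group n\<^esub> z))"
      by (intro sum.cong) (auto simp: sym_group_carrier)
    also have "\<dots> = of_nat (card {z. z permutes {1..n}})"
      unfolding \<xi>' character_norm by (simp add: Coset.order_def sym_group_def)
    finally show "(\<Sum>z | z permutes {1..n}. \<xi> z * \<xi> (inv' z)) = of_nat (card {z. z permutes {1..n}})" .
    show "\<xi> z = undefined" if "\<not> z permutes {1..n}" for z
      using that by (simp add: \<xi>' character_of_def sym_group_carrier)
  qed
  define \<rho> where "\<rho> z = \<chi> z / \<chi> id" for z
  have \<chi>\<rho>: "\<chi> z = of_nat a * \<rho> z" and \<psi>\<rho>: "\<psi> z = of_nat b * \<rho> z" if "z permutes {1..n}" for z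
    using ratio[OF that] a b by (simp_all add: \<rho>_def field_simps)
  have fin: "finite {z. z permutes {1..n}}" by (simp add: finite_permutations)
  have "{z. z permutes {1..n}} \<noteq> {}" using permutes_id by blast
  hence card: "of_nat (card {z. z permutes {1..n}}) \<noteq> (0 :: complex)"
    using fin by (simp only: of_nat_eq_0_iff card_0_eq not_False_eq_True)
  let ?s = "\<Sum>z | z permutes {1..n}. \<rho> z * \<rho> (inv' z)"
  have "of_nat (card {z. z permutes {1..n}}) = of_nat (a\<^sup>2) * ?s"
    unfolding norm[OF \<chi>, symmetric] sum_distrib_left
    by (intro sum.cong) (auto simp: \<chi>\<rho> permutes_inv power2_eq_square)
  moreover have "of_nat (card {z. z permutes {1..n}}) = of_nat (b\<^sup>2) * ?s"
    unfolding norm[OF \<psi>, symmetric] sum_distrib_left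
    by (intro sum.cong) (auto simp: \<psi>\<rho> permutes_inv power2_eq_square)
  ultimately have "of_nat (a\<^sup>2) = (of_nat (b\<^sup>2) :: complex)" using card by auto
  hence "a = b" unfolding of_nat_eq_iff by simp
  show ?thesis
  proof
    fix z show "\<chi> z = \<psi> z"
      using \<chi>\<rho> \<psi>\<rho> ext[OF \<chi>] ext[OF \<psi>] \<open>a = b\<close> by (cases "z permutes {1..n}") auto
  qed
qed

lemma mono_sums:
  assumes "bounded_mono A S b"
  shows "(\<Sum>i=1..A. Poly_Mapping.lookup b (i + 1) * i) = mono_weight b"
    and "(\<Sum>i=1..A. Poly_Mapping.lookup b (i + 1) * (i + 1)) = mono_size b"
proof -
  have keys: "Poly_Mapping.keys b \<subseteq> {2..A + 1}" using assms by (simp add: bounded_mono_def)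
  have shift: "(\<Sum>i=1..A. f (i + 1)) = (\<Sum>r=2..A + 1. f r)" for f :: "nat \<Rightarrow> nat"
    using sum.shift_bounds_cl_nat_ivl[of f 1 1 A] by (simp add: numeral_2_eq_2)
  show "(\<Sum>i=1..A. Poly_Mapping.lookup b (i + 1) * i) = mono_weight b"
    using shift[of "\<lambda>r. Poly_Mapping.lookup b r * (r - 1)"] mono_over_superset(1)[OF _ keys] by simp
  show "(\<Sum>i=1..A. Poly_Mapping.lookup b (i + 1) * (i + 1)) = mono_size b"
    using shift[of "\<lambda>r. Poly_Mapping.lookup b r * r"] mono_over_superset(2)[OF _ keys] by simp
qed

theorem theorem2p4:
  shows
    "(\<exists>F :: nat \<Rightarrow> complex list \<Rightarrow> (nat \<Rightarrow> nat) \<Rightarrow> complex.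
        \<forall>n\<ge>1. \<forall>\<chi>\<in>Irr (sym_group n).
          \<chi> = F n (map (\<lambda>r. char_ratio n \<chi> {#r#}) [2..<n + 1])) \<and>
     (\<forall>(m::nat) \<mu>. m \<ge> 1 \<and> is_partition_of \<mu> m \<longrightarrow>
        (\<exists>T :: ratfun_mpoly.
           mpoly_vars T \<subseteq> {2..part_norm \<mu> + 1} \<and>
           (\<forall>n\<ge>m.
              (\<forall>b\<in>Poly_Mapping.keys T. ratfun_defined_at (Poly_Mapping.lookup T b) (of_nat n)) \<and>
              (\<forall>\<chi>\<in>Irr (sym_group n).
                 char_ratio n \<chi> \<mu> = mpoly_eval T (\<lambda>r. char_ratio n \<chi> {#r#}) n)) \<and>
           (\<forall>b\<in>Poly_Mapping.keys T. \<forall>p q :: rat poly.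
              q \<noteq> 0 \<and> coprime p q \<and> Poly_Mapping.lookup T b = to_fract p / to_fract q \<longrightarrow>
                degree p \<le> degree q \<and>
                (\<Sum>i=1..part_norm \<mu>. Poly_Mapping.lookup b (i + 1) * i) \<le> part_norm \<mu> \<and>
                [(\<Sum>i=1..part_norm \<mu>. Poly_Mapping.lookup b (i + 1) * i) = part_norm \<mu>] (mod 2) \<and>
                (\<Sum>i=1..part_norm \<mu>. Poly_Mapping.lookup b (i + 1) * (i + 1)) \<le> part_supp \<mu>)))"
proof (intro conjI allI impI)
  define ratios where "ratios n \<chi> = map (\<lambda>r. char_ratio n \<chi> {#r#}) [2..<n + 1]" for n \<chi>
  have "\<chi> = \<psi>"
    if "n \<ge> 1" "\<chi> \<in> Irr (sym_group n)" "\<psi> \<in> Irr (sym_group n)" "ratios n \<chi> = ratios n \<psi>" for n \<chi> \<psi>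
    using that(4) by (intro Irr_sym_group_determined[OF that(1-3)]) (auto simp: ratios_def)
  hence "\<forall>n\<ge>1. \<forall>\<chi>\<in>Irr (sym_group n).
      \<chi> = inv_into (Irr (sym_group n)) (ratios n) (ratios n \<chi>)"
    by (metis inv_into_f_f inj_onI)
  thus "\<exists>F :: nat \<Rightarrow> complex list \<Rightarrow> (nat \<Rightarrow> nat) \<Rightarrow> complex. \<forall>n\<ge>1. \<forall>\<chi>\<in>Irr (sym_group n).
      \<chi> = F n (map (\<lambda>r. char_ratio n \<chi> {#r#}) [2..<n + 1])"
    unfolding ratios_def[symmetric] by (intro exI[of _ "\<lambda>n. inv_into (Irr (sym_group n)) (ratios n)"])
next
  fix m \<mu> assume "m \<ge> 1 \<and> is_partition_of \<mu> m"
  then obtain T :: ratfun_mpoly where coeff: "\<forall>b. regular_coeff m (Poly_Mapping.lookup T b)"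
    and mono: "\<forall>b\<in>Poly_Mapping.keys T. bounded_mono (part_norm \<mu>) (part_supp \<mu>) b"
    and eval: "\<forall>n\<ge>m. \<forall>\<chi>\<in>Irr (sym_group n).
       char_ratio n \<chi> \<mu> = mpoly_eval T (\<lambda>r. char_ratio n \<chi> {#r#}) n"
    using char_ratio_polynomial by blast
  show "\<exists>T :: ratfun_mpoly.
           mpoly_vars T \<subseteq> {2..part_norm \<mu> + 1} \<and>
           (\<forall>n\<ge>m.
              (\<forall>b\<in>Poly_Mapping.keys T. ratfun_defined_at (Poly_Mapping.lookup T b) (of_nat n)) \<and>
              (\<forall>\<chi>\<in>Irr (sym_group n).
                 char_ratio n \<chi> \<mu> = mpoly_eval T (\<lambda>r. char_ratio n \<chi> {#r#}) n)) \<and>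
           (\<forall>b\<in>Poly_Mapping.keys T. \<forall>p q :: rat poly.
              q \<noteq> 0 \<and> coprime p q \<and> Poly_Mapping.lookup T b = to_fract p / to_fract q \<longrightarrow>
                degree p \<le> degree q \<and>
                (\<Sum>i=1..part_norm \<mu>. Poly_Mapping.lookup b (i + 1) * i) \<le> part_norm \<mu> \<and>
                [(\<Sum>i=1..part_norm \<mu>. Poly_Mapping.lookup b (i + 1) * i) = part_norm \<mu>] (mod 2) \<and>
                (\<Sum>i=1..part_norm \<mu>. Poly_Mapping.lookup b (i + 1) * (i + 1)) \<le> part_supp \<mu>)"
  proof (intro exI[of _ T] conjI ballI allI impI)
    show "mpoly_vars T \<subseteq> {2..part_norm \<mu> + 1}"
      using mono unfolding mpoly_vars_def bounded_mono_def by blast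
  next
    fix n b assume "m \<le> n"
    thus "ratfun_defined_at (Poly_Mapping.lookup T b) (of_nat n)"
      using coeff regular_coeff_defined by blast
  next
    fix n \<chi> assume "m \<le> n" "\<chi> \<in> Irr (sym_group n)"
    thus "char_ratio n \<chi> \<mu> = mpoly_eval T (\<lambda>r. char_ratio n \<chi> {#r#}) n" using eval by blast
  next
    fix b and p q :: "rat poly"
    assume "q \<noteq> 0 \<and> coprime p q \<and> Poly_Mapping.lookup T b = to_fract p / to_fract q"
    thus "degree p \<le> degree q" using coeff regular_coeff_degree_le by blast
  next
    fix b assume "b \<in> Poly_Mapping.keys T"
    hence b: "bounded_mono (part_norm \<mu>) (part_supp \<mu>) b" using mono by blast
    show "(\<Sum>i=1..part_norm \<mu>. Poly_Mapping.lookup b (i + 1) * i) \<le> part_norm \<mu>"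
      and "[(\<Sum>i=1..part_norm \<mu>. Poly_Mapping.lookup b (i + 1) * i) = part_norm \<mu>] (mod 2)"
      and "(\<Sum>i=1..part_norm \<mu>. Poly_Mapping.lookup b (i + 1) * (i + 1)) \<le> part_supp \<mu>"
      using b unfolding mono_sums[OF b] by (auto simp: bounded_mono_def)
  qed
qed

end
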